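(* There is an algorithm which, given as input MV-terms $\tau_1,\ldots,\tau_u$ in the variables $X_1,\ldots,X_n$, outputs a positive integer $m$ and an MV-term $\sigma(Y_1,\ldots,Y_m)$ such that the subalgebra $A$ of $\mathcal M([0,1]^n)$ generated by $\hat\tau_1,\ldots,\hat\tau_u$ is isomorphic to the quotient MV-algebra $\mathcal M([0,1]^m)/\mathfrak j_\sigma$, where $\mathfrak j_\sigma$ is the principal ideal of $\mathcal M([0,1]^m)$ generated by $\hat\sigma$.
   Context: A McNaughton function on $[0,1]^n$ is a continuous function $f\colon[0,1]^n\to[0,1]$ for which there are finitely many affine functions with integer coefficients $p_1,\ldots,p_m$ such that for every $x$ there is $j$ with $f(x)=p_j(x)$; $\mathcal M([0,1]^n)$ is the MV-algebra of these with pointwise operations $f\oplus g=\min(1,f+g)$, $\neg f=1-f$, $0$ (the free $n$-generator MV-algebra). An MV-term $\tau(X_1,\ldots,X_n)$ is a string built from the variables and $0$ by finitely many applications of $\neg$ and $\oplus$; $\hat\tau$ is obtained by interpreting $X_i$ as the $i$-th coordinate function and the connectives pointwise. An ideal of an MV-algebra is a downward closed subset containing $0$ and closed under $\oplus$; the principal ideal generated by $g$ is the smallest ideal containing $g$. *)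

theory Defs
  imports "HOL-Analysis.Analysis" "HOL-Algebra.Congruence" "HOL-Library.Nat_Bijection"
begin

section \<open>MV-algebras as structures\<close>

record 'a mv_alg = "'a partial_object" +
  mv_plus :: "'a \<Rightarrow> 'a \<Rightarrow> 'a"
  mv_neg :: "'a \<Rightarrow> 'a"
  mv_zero :: 'a

text \<open>The usual derived notions: \<open>1 = \<not> 0\<close>, \<open>x \<le> y\<close> iff \<open>\<not> x \<oplus> y = 1\<close>, truncated difference
  \<open>x \<ominus> y = \<not> (\<not> x \<oplus> y)\<close>, and the distance \<open>(x \<ominus> y) \<oplus> (y \<ominus> x)\<close>.\<close>

definition mv_one :: "('a, 'b) mv_alg_scheme \<Rightarrow> 'a" where
  "mv_one A = mv_neg A (mv_zero A)"

definition mv_le :: "('a, 'b) mv_alg_scheme \<Rightarrow> 'a \<Rightarrow> 'a \<Rightarrow> bool" where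
  "mv_le A x y \<longleftrightarrow> mv_plus A (mv_neg A x) y = mv_one A"

definition mv_diff :: "('a, 'b) mv_alg_scheme \<Rightarrow> 'a \<Rightarrow> 'a \<Rightarrow> 'a" where
  "mv_diff A x y = mv_neg A (mv_plus A (mv_neg A x) y)"

definition mv_dist :: "('a, 'b) mv_alg_scheme \<Rightarrow> 'a \<Rightarrow> 'a \<Rightarrow> 'a" where
  "mv_dist A x y = mv_plus A (mv_diff A x y) (mv_diff A y x)"

definition mv_subalgebra :: "('a, 'b) mv_alg_scheme \<Rightarrow> 'a set \<Rightarrow> bool" where
  "mv_subalgebra A S \<longleftrightarrow> S \<subseteq> carrier A \<and> mv_zero A \<in> S \<and>
     (\<forall>x\<in>S. mv_neg A x \<in> S) \<and> (\<forall>x\<in>S. \<forall>y\<in>S. mv_plus A x y \<in> S)"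

definition mv_generated :: "'a mv_alg \<Rightarrow> 'a set \<Rightarrow> 'a mv_alg" where
  "mv_generated A G = A\<lparr>carrier := mv_subalgebra A hull G\<rparr>"

definition mv_ideal :: "('a, 'b) mv_alg_scheme \<Rightarrow> 'a set \<Rightarrow> bool" where
  "mv_ideal A J \<longleftrightarrow> J \<subseteq> carrier A \<and> mv_zero A \<in> J \<and>
     (\<forall>x\<in>J. \<forall>y\<in>carrier A. mv_le A y x \<longrightarrow> y \<in> J) \<and>
     (\<forall>x\<in>J. \<forall>y\<in>J. mv_plus A x y \<in> J)"

definition mv_principal_ideal :: "('a, 'b) mv_alg_scheme \<Rightarrow> 'a \<Rightarrow> 'a set" where
  "mv_principal_ideal A g = mv_ideal A hull {g}"

definition mv_cong :: "('a, 'b) mv_alg_scheme \<Rightarrow> 'a set \<Rightarrow> 'a rel" where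
  "mv_cong A J = {(x, y). x \<in> carrier A \<and> y \<in> carrier A \<and> mv_dist A x y \<in> J}"

text \<open>The operations below are \<open>[x] \<oplus> [y] = [x \<oplus> y]\<close> and \<open>\<not> [x] = [\<not> x]\<close>: for an ideal \<open>J\<close> of an
  MV-algebra the relation is a congruence, so all classes in each union coincide.\<close>

definition mv_quotient :: "('a, 'b) mv_alg_scheme \<Rightarrow> 'a set \<Rightarrow> 'a set mv_alg" where
  "mv_quotient A J =
     \<lparr>carrier = carrier A // mv_cong A J,
      mv_plus = (\<lambda>X Y. \<Union>x\<in>X. \<Union>y\<in>Y. mv_cong A J `` {mv_plus A x y}),
      mv_neg = (\<lambda>X. \<Union>x\<in>X. mv_cong A J `` {mv_neg A x}),
      mv_zero = mv_cong A J `` {mv_zero A}\<rparr>"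

definition mv_hom :: "('a, 'c) mv_alg_scheme \<Rightarrow> ('b, 'd) mv_alg_scheme \<Rightarrow> ('a \<Rightarrow> 'b) set" where
  "mv_hom A B = {h. h \<in> carrier A \<rightarrow> carrier B \<and> h (mv_zero A) = mv_zero B \<and>
     (\<forall>x\<in>carrier A. h (mv_neg A x) = mv_neg B (h x)) \<and>
     (\<forall>x\<in>carrier A. \<forall>y\<in>carrier A. h (mv_plus A x y) = mv_plus B (h x) (h y))}"

definition mv_isomorphic :: "('a, 'c) mv_alg_scheme \<Rightarrow> ('b, 'd) mv_alg_scheme \<Rightarrow> bool" where
  "mv_isomorphic A B \<longleftrightarrow> (\<exists>h\<in>mv_hom A B. bij_betw h (carrier A) (carrier B))"


section \<open>McNaughton functions\<close>

text \<open>Points of \<open>[0,1]\<^sup>n\<close> are extensional functions on \<open>{..<n}\<close>. Their coordinates outside \<open>{..<n}\<close>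
  are all fixed, so the product topology on \<open>nat \<Rightarrow> real\<close> induces the Euclidean one.\<close>

definition cube :: "nat \<Rightarrow> (nat \<Rightarrow> real) set" where
  "cube n = (\<Pi>\<^sub>E i\<in>{..<n}. {0..1})"

definition int_affine :: "nat \<Rightarrow> ((nat \<Rightarrow> real) \<Rightarrow> real) \<Rightarrow> bool" where
  "int_affine n p \<longleftrightarrow>
     (\<exists>(b::int) (a::nat \<Rightarrow> int). \<forall>x. p x = of_int b + (\<Sum>i<n. of_int (a i) * x i))"

text \<open>Extensionality makes equality in the carrier equality of functions on the cube.\<close>

definition mcnaughton :: "nat \<Rightarrow> ((nat \<Rightarrow> real) \<Rightarrow> real) set" where
  "mcnaughton n = {f \<in> cube n \<rightarrow>\<^sub>E {0..1}. continuous_on (cube n) f \<and>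
     (\<exists>P. finite P \<and> (\<forall>p\<in>P. int_affine n p) \<and> (\<forall>x\<in>cube n. \<exists>p\<in>P. f x = p x))}"

definition mcn :: "nat \<Rightarrow> ((nat \<Rightarrow> real) \<Rightarrow> real) mv_alg" where
  "mcn n =
     \<lparr>carrier = mcnaughton n,
      mv_plus = (\<lambda>f g. \<lambda>x\<in>cube n. min 1 (f x + g x)),
      mv_neg = (\<lambda>f. \<lambda>x\<in>cube n. 1 - f x),
      mv_zero = (\<lambda>x\<in>cube n. 0)\<rparr>"


section \<open>MV-terms\<close>

text \<open>Variables are numbered from 0: \<open>TVar i\<close> is \<open>X\<^bsub>i+1\<^esub>\<close>.\<close>

datatype mvterm = TVar nat | TZero | TNeg mvterm | TPlus mvterm mvterm

primrec term_vars :: "mvterm \<Rightarrow> nat set" where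
  "term_vars (TVar i) = {i}"
| "term_vars TZero = {}"
| "term_vars (TNeg s) = term_vars s"
| "term_vars (TPlus s t) = term_vars s \<union> term_vars t"

primrec mv_interp :: "('a, 'b) mv_alg_scheme \<Rightarrow> (nat \<Rightarrow> 'a) \<Rightarrow> mvterm \<Rightarrow> 'a" where
  "mv_interp A e (TVar i) = e i"
| "mv_interp A e TZero = mv_zero A"
| "mv_interp A e (TNeg s) = mv_neg A (mv_interp A e s)"
| "mv_interp A e (TPlus s t) = mv_plus A (mv_interp A e s) (mv_interp A e t)"

definition term_fun :: "nat \<Rightarrow> mvterm \<Rightarrow> (nat \<Rightarrow> real) \<Rightarrow> real" where
  "term_fun n = mv_interp (mcn n) (\<lambda>i. \<lambda>x\<in>cube n. x i)"

primrec term_code :: "mvterm \<Rightarrow> nat" where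
  "term_code (TVar i) = prod_encode (0, i)"
| "term_code TZero = prod_encode (1, 0)"
| "term_code (TNeg s) = prod_encode (2, term_code s)"
| "term_code (TPlus s t) = prod_encode (3, prod_encode (term_code s, term_code t))"

lemma term_code_inj: "inj term_code"
proof (rule injI)
  fix s t assume "term_code s = term_code t"
  then show "s = t"
  proof (induction s arbitrary: t)
    case (TVar i) then show ?case by (cases t) auto
  next
    case TZero then show ?case by (cases t) auto
  next
    case (TNeg s) then show ?case by (cases t) auto
  next
    case (TPlus s1 s2) then show ?case by (cases t) auto
  qed
qed


section \<open>Algorithms\<close>

text \<open>Algorithms are programs for partial recursive functions (Kleene). \<open>rec_eval p xs y\<close> means
  that program \<open>p\<close> halts on the arguments \<open>xs\<close> with result \<open>y\<close>.\<close>

datatype recf = RZero | RSucc | RProj nat | RComp recf "recf list" | RPrim recf recf | RMu recf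

inductive rec_eval :: "recf \<Rightarrow> nat list \<Rightarrow> nat \<Rightarrow> bool" where
  zero: "rec_eval RZero xs 0"
| succ: "rec_eval RSucc [x] (Suc x)"
| proj: "i < length xs \<Longrightarrow> rec_eval (RProj i) xs (xs ! i)"
| comp: "length ys = length gs \<Longrightarrow> (\<forall>i<length gs. rec_eval (gs ! i) xs (ys ! i)) \<Longrightarrow>
    rec_eval f ys z \<Longrightarrow> rec_eval (RComp f gs) xs z"
| prim_0: "rec_eval f xs y \<Longrightarrow> rec_eval (RPrim f g) (0 # xs) y"
| prim_Suc: "rec_eval (RPrim f g) (k # xs) y \<Longrightarrow> rec_eval g (k # y # xs) z \<Longrightarrow>
    rec_eval (RPrim f g) (Suc k # xs) z"
| mu: "rec_eval f (k # xs) 0 \<Longrightarrow> (\<forall>i<k. \<exists>y. rec_eval f (i # xs) (Suc y)) \<Longrightarrow>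
    rec_eval (RMu f) xs k"

lemma rec_eval_deterministic: "rec_eval p xs y \<Longrightarrow> rec_eval p xs z \<Longrightarrow> z = y"
proof (induction arbitrary: z rule: rec_eval.induct)
  case (zero xs)
  then show ?case by (cases rule: rec_eval.cases) auto
next
  case (succ x)
  then show ?case by (cases rule: rec_eval.cases) auto
next
  case (proj i xs)
  from proj(2) show ?case by (cases rule: rec_eval.cases) auto
next
  case (comp ys gs xs f w)
  from comp.prems obtain ys' where ys': "length ys' = length gs"
    "\<forall>i<length gs. rec_eval (gs ! i) xs (ys' ! i)" "rec_eval f ys' z"
    by (cases rule: rec_eval.cases) auto
  have "ys' = ys"
    using comp.IH(1) comp.hyps(1) ys'(1,2) by (auto intro!: nth_equalityI)
  then show ?case using comp.IH(2) ys'(3) by blast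
next
  case (prim_0 f xs y g)
  from prim_0.prems show ?case using prim_0.IH by (cases rule: rec_eval.cases) auto
next
  case (prim_Suc f g k xs y w)
  from prim_Suc.prems obtain y' where "rec_eval (RPrim f g) (k # xs) y'"
    "rec_eval g (k # y' # xs) z"
    by (cases rule: rec_eval.cases) auto
  then show ?case using prim_Suc.IH by blast
next
  case (mu f k xs)
  from mu.prems have z: "rec_eval f (z # xs) 0" "\<forall>i<z. \<exists>y. rec_eval f (i # xs) (Suc y)"
    by (cases rule: rec_eval.cases; auto)+
  have "\<not> z < k" using mu.IH(2) z(1) by fastforce
  moreover have "\<not> k < z" using mu.IH(1) z(2) by fastforce
  ultimately show ?case by simp
qed

end

(* The homomorphism f |-> f o T with T = (tau_1, ..., tau_u) maps the free algebra onto the generated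
   subalgebra, and its kernel consists of the functions that vanish on the rational polyhedron
   R = T([0,1]^n). A McNaughton function vanishing on the zero set of sigma is dominated by a multiple
   of sigma, so the kernel is the principal ideal of any term sigma with zero set R. Such a term is
   computed by describing the graph of T by integer linear inequalities, projecting to R by
   Fourier-Motzkin elimination, and translating each remaining inequality into a term.

   Two facts about McNaughton functions are needed. They are given by terms, because each is a maximum
   of minima of its affine pieces. For the domination, the ratios g(x)/f(x) form a projection of a
   polyhedron, hence a closed set; as it omits 0, it is bounded away from 0. *)

theory Submission
  imports Defs
begin

section \<open>Computable functions on encoded data\<close>

text \<open>Computability is proved for a concrete machine model through closure rules, so every
  construction of the algorithm is a total function on lists, integers and terms built from maps,
  folds and bounded iteration, with generous bounds.

  Linear forms are homogeneous because the unit coordinate has two uses: for the range it survives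
  the projection and is set to 1, for the ratios it is a scale that is eliminated together with the
  point. Only weak inequalities occur; this makes the projected sets closed, and zero sets of terms.
  Eliminated variables are nonnegative, so 0 is always a lower bound to try, and a finite list of
  candidates turns projection into a disjunction.

  The obstacle in the domination is that the ratio is defined only where the dominated function is
  nonzero, which in general is not a compact set: it might tend to 0 towards a common zero.
  Piecewise linearity excludes this. Since the polyhedra with a scale coordinate may be unbounded,
  closedness of the projection is read off the elimination and not obtained from
  compactness.\<close>

class encodable =
  fixes enc :: "'a \<Rightarrow> nat"

instantiation nat :: encodable
begin
definition "enc (n::nat) = n"
instance ..
end

instantiation bool :: encodable
begin
definition "enc b = (if b then 1 else (0::nat))"
instance ..
end

instantiation prod :: (encodable, encodable) encodable
begin
definition "enc z = prod_encode (enc (fst z), enc (snd z))"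
instance ..
end

instantiation list :: (encodable) encodable
begin
definition "enc l = list_encode (map enc l)"
instance ..
end

instantiation int :: encodable
begin
definition "enc i = prod_encode (nat i, nat (- i))"
instance ..
end

instantiation mvterm :: encodable
begin
definition "enc t = term_code t"
instance ..
end

lemma enc_list_simps [simp]:
  "enc [] = 0"
  "enc (x # xs) = Suc (prod_encode (enc x, enc xs))"
  by (simp_all add: enc_list_def)

lemma enc_mvterm_simps [simp]:
  "enc (TVar i) = prod_encode (0, i)"
  "enc TZero = prod_encode (1, 0)"
  "enc (TNeg s) = prod_encode (2, enc s)"
  "enc (TPlus s t) = prod_encode (3, prod_encode (enc s, enc t))"
  by (simp_all add: enc_mvterm_def)

lemma rec_eval_comp1:
  "rec_eval g xs y \<Longrightarrow> rec_eval f [y] z \<Longrightarrow> rec_eval (RComp f [g]) xs z"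
  by (rule rec_eval.comp[where ys = "[y]"]) auto

lemma rec_eval_comp2:
  "rec_eval g xs y \<Longrightarrow> rec_eval h xs y' \<Longrightarrow> rec_eval f [y, y'] z \<Longrightarrow>
    rec_eval (RComp f [g, h]) xs z"
  by (rule rec_eval.comp[where ys = "[y, y']"]) (auto simp: less_Suc_eq nth_Cons')

lemma rec_eval_proj:
  "rec_eval (RProj 0) (x # xs) x"
  "rec_eval (RProj (Suc 0)) (x # y # xs) y"
  "rec_eval (RProj 2) (x # y # z # xs) z"
  using rec_eval.proj[of 0 "x # xs"] rec_eval.proj[of 1 "x # y # xs"]
    rec_eval.proj[of 2 "x # y # z # xs"] by auto

section \<open>Programs for arithmetic, pairing and branching\<close>

definition radd :: recf where
  "radd = RPrim (RProj 0) (RComp RSucc [RProj (Suc 0)])"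

lemma rec_eval_radd: "rec_eval radd [a, b] (a + b)"
  unfolding radd_def
  by (induction a) (auto intro: rec_eval.intros rec_eval_proj rec_eval_comp1)

definition rpred :: recf where
  "rpred = RPrim RZero (RProj 0)"

lemma rec_eval_rpred: "rec_eval rpred [a] (a - 1)"
  unfolding rpred_def
  by (induction a) (auto intro: rec_eval.intros rec_eval_proj)

definition rsub :: recf where
  "rsub = RPrim (RProj 0) (RComp rpred [RProj (Suc 0)])"

lemma rec_eval_rsub: "rec_eval rsub [a, b] (b - a)"
  unfolding rsub_def
proof (induction a)
  case (Suc a)
  have "rec_eval (RComp rpred [RProj (Suc 0)]) [a, b - a, b] (b - Suc a)"
    using rec_eval_comp1[OF rec_eval_proj(2) rec_eval_rpred, of a "b - a" "[b]"] by simp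
  then show ?case
    using Suc by (auto intro: rec_eval.prim_Suc)
qed (auto intro: rec_eval.intros rec_eval_proj)

definition rtriangle :: recf where
  "rtriangle = RPrim RZero (RComp radd [RProj (Suc 0), RComp RSucc [RProj 0]])"

lemma rec_eval_rtriangle: "rec_eval rtriangle [a] (triangle a)"
  unfolding rtriangle_def
proof (induction a)
  case (Suc a)
  have "rec_eval (RComp radd [RProj (Suc 0), RComp RSucc [RProj 0]]) [a, triangle a]
      (triangle a + Suc a)"
    by (rule rec_eval_comp2 rec_eval_comp1 rec_eval_proj rec_eval.succ rec_eval_radd)+
  then show ?case
    using Suc by (auto intro: rec_eval.prim_Suc)
qed (auto intro: rec_eval.intros)

definition rpair :: recf where
  "rpair = RComp radd [RComp rtriangle [radd], RProj 0]"

lemma rec_eval_rpair: "rec_eval rpair [a, b] (prod_encode (a, b))"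
  unfolding rpair_def prod_encode_def prod.case
  by (rule rec_eval_comp2 rec_eval_comp1 rec_eval_proj rec_eval_radd rec_eval_rtriangle)+

text \<open>\<open>prod_encode (a, b)\<close> is \<open>triangle (a + b) + a\<close> and lies below
  \<open>triangle (Suc (a + b))\<close>, so \<open>a + b\<close> is the least \<open>k\<close> for
  which \<open>triangle (Suc k)\<close> exceeds the code. This is the only unbounded search in the
  algorithm.\<close>

definition rdiag :: recf where
  "rdiag = RMu (RComp rsub [RComp rtriangle [RComp RSucc [RProj 0]], RComp RSucc [RProj (Suc 0)]])"

lemma triangle_mono: "a \<le> b \<Longrightarrow> triangle a \<le> triangle b"
  by (induction b) (auto simp: le_Suc_eq)

lemma rec_eval_rdiag: "rec_eval rdiag [prod_encode (a, b)] (a + b)"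
proof -
  let ?f = "RComp rsub [RComp rtriangle [RComp RSucc [RProj 0]], RComp RSucc [RProj (Suc 0)]]"
  have f: "rec_eval ?f [k, z] (Suc z - triangle (Suc k))" for k z
    by (rule rec_eval_comp2 rec_eval_comp1 rec_eval_proj rec_eval.succ rec_eval_rsub
        rec_eval_rtriangle)+
  have "rec_eval ?f [a + b, prod_encode (a, b)] 0"
    using f[of "a + b" "prod_encode (a, b)"] by (simp add: prod_encode_def)
  moreover have "\<exists>y. rec_eval ?f [i, prod_encode (a, b)] (Suc y)" if "i < a + b" for i
  proof -
    have "triangle (Suc i) \<le> prod_encode (a, b)"
      using triangle_mono[of "Suc i" "a + b"] that by (simp add: prod_encode_def)
    then show ?thesis
      using f[of i "prod_encode (a, b)"] by (metis Suc_diff_le)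
  qed
  ultimately show ?thesis
    unfolding rdiag_def by (intro rec_eval.mu) auto
qed

definition rfst :: recf where
  "rfst = RComp rsub [RComp rtriangle [rdiag], RProj 0]"

lemma rec_eval_rfst: "rec_eval rfst [prod_encode (a, b)] a"
proof -
  have "rec_eval rfst [prod_encode (a, b)] (prod_encode (a, b) - triangle (a + b))"
    unfolding rfst_def
    by (rule rec_eval_comp2 rec_eval_comp1 rec_eval_proj rec_eval_rsub rec_eval_rtriangle
        rec_eval_rdiag)+
  then show ?thesis by (simp add: prod_encode_def)
qed

definition rsnd :: recf where
  "rsnd = RComp rsub [rfst, rdiag]"

lemma rec_eval_rsnd: "rec_eval rsnd [prod_encode (a, b)] b"
proof -
  have "rec_eval rsnd [prod_encode (a, b)] (a + b - a)"
    unfolding rsnd_def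
    by (rule rec_eval_comp2 rec_eval_rsub rec_eval_rfst rec_eval_rdiag)+
  then show ?thesis by simp
qed

primrec rconst :: "nat \<Rightarrow> recf" where
  "rconst 0 = RZero"
| "rconst (Suc n) = RComp RSucc [rconst n]"

lemma rec_eval_rconst: "rec_eval (rconst n) xs n"
  by (induction n) (auto intro: rec_eval.intros rec_eval_comp1)

definition rnot :: recf where
  "rnot = RPrim (rconst 1) RZero"

lemma rec_eval_rnot: "rec_eval rnot [a] (if a = 0 then 1 else 0)"
  unfolding rnot_def
proof (induction a)
  case (Suc a)
  show ?case
    using rec_eval.prim_Suc[OF Suc rec_eval.zero] by simp
qed (auto intro!: rec_eval.prim_0 rec_eval_rconst[of 1, simplified])

text \<open>The branch not taken may diverge, hence it must not be evaluated: primitive recursion up to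
  the truth value of the guard runs its step only if the guard is nonzero.\<close>

definition rif :: "recf \<Rightarrow> recf \<Rightarrow> recf \<Rightarrow> recf" where
  "rif c f g = RComp radd
     [RComp (RPrim RZero (RComp f [RProj 2])) [c, RProj 0],
      RComp (RPrim RZero (RComp g [RProj 2])) [RComp rnot [c], RProj 0]]"

lemma rec_eval_rif:
  assumes c: "rec_eval c [x] v"
    and f: "v \<noteq> 0 \<Longrightarrow> rec_eval f [x] y"
    and g: "v = 0 \<Longrightarrow> rec_eval g [x] y"
  shows "rec_eval (rif c f g) [x] y"
proof -
  have guard: "rec_eval (RPrim RZero (RComp h [RProj 2])) [w, x] (if w = 0 then 0 else y)"
    if "w \<noteq> 0 \<Longrightarrow> rec_eval h [x] y" for h w
  proof (cases "w = 0")
    case True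
    then show ?thesis by (auto intro: rec_eval.intros)
  next
    case False
    then have h: "rec_eval h [x] y" using that by simp
    have "rec_eval (RPrim RZero (RComp h [RProj 2])) [w, x] (if w = 0 then 0 else y)"
    proof (induction w)
      case 0
      show ?case by (auto intro: rec_eval.intros)
    next
      case (Suc w)
      show ?case
        using rec_eval.prim_Suc[OF Suc rec_eval_comp1[OF rec_eval_proj(3) h]] by simp
    qed
    then show ?thesis .
  qed
  have "rec_eval (rif c f g) [x]
      ((if v = 0 then 0 else y) + (if (if v = 0 then 1 else 0) = (0::nat) then 0 else y))"
    unfolding rif_def
    by (rule rec_eval_comp2[OF rec_eval_comp2[OF c rec_eval_proj(1) guard]
          rec_eval_comp2[OF rec_eval_comp1[OF c rec_eval_rnot] rec_eval_proj(1) guard]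
          rec_eval_radd])
      (auto simp: f g split: if_splits)
  then show ?thesis by (simp split: if_splits)
qed

text \<open>The program is constrained on codes only; its behaviour on numbers that encode nothing
  is left open, so decoders need no validity checks.\<close>

definition computable :: "('a::encodable \<Rightarrow> 'b::encodable) \<Rightarrow> bool" where
  "computable f \<longleftrightarrow> (\<exists>p. \<forall>x. rec_eval p [enc x] (enc (f x)))"

lemma computableI: "(\<And>x. rec_eval p [enc x] (enc (f x))) \<Longrightarrow> computable f"
  by (auto simp: computable_def)

lemma computable_compose:
  assumes "computable g" "computable f"
  shows "computable (\<lambda>x. g (f x))"
proof -
  obtain p q where "\<And>x. rec_eval p [enc x] (enc (g x))" "\<And>x. rec_eval q [enc x] (enc (f x))"
    using assms by (auto simp: computable_def)
  then show ?thesis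
    by (intro computableI[of "RComp p [q]"] rec_eval_comp1)
qed

lemma computable_id: "computable (\<lambda>x. x)"
  by (rule computableI[OF rec_eval_proj(1)])

lemma computable_const: "computable (\<lambda>x. c)"
  by (rule computableI[OF rec_eval_rconst])

lemma computable_enc: "computable f \<Longrightarrow> computable (\<lambda>x. enc (f x))"
  by (simp add: computable_def enc_nat_def)

lemma computable_Pair:
  assumes "computable f" "computable g"
  shows "computable (\<lambda>x. (f x, g x))"
proof -
  obtain p q where "\<And>x. rec_eval p [enc x] (enc (f x))" "\<And>x. rec_eval q [enc x] (enc (g x))"
    using assms by (auto simp: computable_def)
  then show ?thesis
    by (intro computableI[of "RComp rpair [p, q]"])
      (auto simp: enc_prod_def intro: rec_eval_comp2 rec_eval_rpair)
qed

lemma computable_fst: "computable f \<Longrightarrow> computable (\<lambda>x. fst (f x))"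
  by (rule computable_compose[of fst], rule computableI[of rfst])
    (auto simp: enc_prod_def rec_eval_rfst)

lemma computable_snd: "computable f \<Longrightarrow> computable (\<lambda>x. snd (f x))"
  by (rule computable_compose[of snd], rule computableI[of rsnd])
    (auto simp: enc_prod_def rec_eval_rsnd)

text \<open>Arguments of functions with a parameter are collected in nested pairs
  \<open>(e, x, y)\<close>, where \<open>e\<close> is the environment in which the function is formed.\<close>

lemma computable_apply2:
  assumes "computable (\<lambda>p. h (fst p) (snd p))" "computable f" "computable g"
  shows "computable (\<lambda>x. h (f x) (g x))"
  using computable_compose[OF assms(1) computable_Pair[OF assms(2,3)]] by simp

lemma computable_case_prod:
  assumes "computable (\<lambda>p. h (fst p) (fst (snd p)) (snd (snd p)))" "computable f"
  shows "computable (\<lambda>x. case f x of (a, b) \<Rightarrow> h x a b)"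
  using computable_compose[OF assms(1) computable_Pair[OF computable_id assms(2)]]
  by (simp add: case_prod_beta)

lemma computable_if:
  assumes "computable b" "computable f" "computable g"
  shows "computable (\<lambda>x. if b x then f x else g x)"
proof -
  obtain p q r where pqr: "\<And>x. rec_eval p [enc x] (enc (f x))"
    "\<And>x. rec_eval q [enc x] (enc (g x))" "\<And>x. rec_eval r [enc x] (enc (b x))"
    using assms by (auto simp: computable_def)
  have "rec_eval (rif r p q) [enc x] (enc (if b x then f x else g x))" for x
    by (rule rec_eval_rif[OF pqr(3)[of x]]) (use pqr in \<open>auto simp: enc_bool_def split: if_splits\<close>)
  then show ?thesis
    by (rule computableI)
qed

lemma computable_Suc: "computable f \<Longrightarrow> computable (\<lambda>x. Suc (f x))"
  by (rule computable_compose[of Suc], rule computableI[of RSucc])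
    (auto simp: enc_nat_def rec_eval.succ)

text \<open>The step of the primitive recursion reads nothing but the accumulator. The parameter
  \<open>x\<close>, on which \<open>h\<close> depends, is therefore carried along as a first
  component of the state that never changes.\<close>

lemma computable_funpow:
  fixes h :: "'a::encodable \<Rightarrow> 'b::encodable \<Rightarrow> 'b"
  assumes "computable (\<lambda>p. h (fst p) (snd p))" "computable k" "computable s"
  shows "computable (\<lambda>x. (h x ^^ k x) (s x))"
proof -
  define H where "H = (\<lambda>p. (fst p, h (fst p) (snd p)))"
  have "computable H"
    unfolding H_def by (intro computable_Pair computable_fst computable_id assms)
  then obtain p where p: "\<And>x. rec_eval p [enc x] (enc (H x))"
    by (auto simp: computable_def)
  have iter: "rec_eval (RPrim (RProj 0) (RComp p [RProj (Suc 0)])) [n, enc x] (enc ((H ^^ n) x))"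
    for n x
  proof (induction n)
    case 0
    show ?case by (simp add: rec_eval.prim_0 rec_eval_proj)
  next
    case (Suc n)
    show ?case
      using rec_eval.prim_Suc[OF Suc rec_eval_comp1[OF rec_eval_proj(2) p]] by simp
  qed
  have pow: "(H ^^ n) (x, y) = (x, (h x ^^ n) y)" for n x y
    by (induction n) (auto simp: H_def)
  have "rec_eval (RComp (RPrim (RProj 0) (RComp p [RProj (Suc 0)])) [rfst, rsnd])
      [enc q] (enc ((H ^^ fst q) (snd q)))" for q :: "nat \<times> _"
    unfolding enc_prod_def[of q] enc_nat_def[of "fst q"]
    by (rule rec_eval_comp2 rec_eval_rfst rec_eval_rsnd iter)+
  then have "computable (\<lambda>q. (H ^^ fst q) (snd q))"
    by (rule computableI)
  from computable_snd[OF computable_compose[OF this, of "\<lambda>x. (k x, x, s x)"]]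
  show ?thesis
    by (simp add: pow computable_Pair computable_id assms)
qed

section \<open>Arithmetic on natural numbers and integers\<close>

lemma computable_pred: "computable f \<Longrightarrow> computable (\<lambda>x. f x - (1::nat))"
  by (rule computable_compose[of "\<lambda>n. n - 1"], rule computableI[of rpred])
    (auto simp: enc_nat_def rec_eval_rpred[simplified])

lemma computable_plus_nat:
  assumes "computable f" "computable g"
  shows "computable (\<lambda>x. f x + (g x :: nat))"
proof -
  have "computable (\<lambda>x. (Suc ^^ f x) (g x))"
    by (intro computable_funpow computable_Suc computable_snd computable_id assms)
  then show ?thesis by (simp add: Suc_funpow)
qed

lemma computable_diff_nat:
  assumes "computable f" "computable g"
  shows "computable (\<lambda>x. f x - (g x :: nat))"
proof -
  have "computable (\<lambda>x. ((\<lambda>n. n - 1) ^^ g x) (f x))"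
    by (intro computable_funpow computable_pred computable_snd computable_id assms)
  moreover have "((\<lambda>n. n - 1) ^^ b) a = a - b" for a b :: nat
    by (induction b) auto
  ultimately show ?thesis by simp
qed

lemma computable_times_nat:
  assumes "computable f" "computable g"
  shows "computable (\<lambda>x. f x * (g x :: nat))"
proof -
  have "computable (\<lambda>x. ((\<lambda>n. g x + n) ^^ f x) 0)"
    by (intro computable_funpow computable_plus_nat computable_compose[OF assms(2)]
        computable_fst computable_snd computable_id computable_const assms)
  moreover have "((\<lambda>n. b + n) ^^ a) 0 = a * b" for a b :: nat
    by (induction a) auto
  ultimately show ?thesis by simp
qed

lemma computable_eq_0:
  assumes "computable f"
  shows "computable (\<lambda>x. f x = (0::nat))"
proof -
  obtain p where "\<And>x. rec_eval p [enc x] (f x)"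
    using assms by (auto simp: computable_def enc_nat_def)
  from rec_eval_comp1[OF this rec_eval_rnot] show ?thesis
    by (intro computableI[of "RComp rnot [p]"]) (simp add: enc_bool_def)
qed

lemma computable_not:
  assumes "computable b"
  shows "computable (\<lambda>x. \<not> b x)"
proof -
  have "computable (\<lambda>x. if b x then False else True)"
    by (intro computable_if computable_const assms)
  moreover have "(if P then False else True) \<longleftrightarrow> \<not> P" for P by simp
  ultimately show ?thesis by presburger
qed

lemma computable_eq_nat:
  assumes "computable f" "computable g"
  shows "computable (\<lambda>x. f x = (g x :: nat))"
proof -
  have "computable (\<lambda>x. (f x - g x) + (g x - f x) = 0)"
    by (intro computable_eq_0 computable_plus_nat computable_diff_nat assms)
  moreover have "(a - b) + (b - a) = 0 \<longleftrightarrow> a = b" for a b :: nat by auto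
  ultimately show ?thesis by simp
qed

text \<open>An integer is encoded as the pair \<open>(nat i, nat (- i))\<close>, so that the operations reduce to
  truncated arithmetic on the two components.\<close>

lemma computable_nat: "computable f \<Longrightarrow> computable (\<lambda>x. nat (f x))"
  by (rule computable_compose[of nat], rule computableI[of rfst])
    (auto simp: enc_int_def enc_nat_def rec_eval_rfst)

lemma computable_nat_minus: "computable f \<Longrightarrow> computable (\<lambda>x. nat (- f x))"
  by (rule computable_compose[of "\<lambda>i. nat (- i)"], rule computableI[of rsnd])
    (auto simp: enc_int_def enc_nat_def rec_eval_rsnd)

lemma computable_int_diff:
  assumes "computable f" "computable g"
  shows "computable (\<lambda>x. int (f x) - int (g x))"
proof -
  have "computable (\<lambda>x. (f x - g x, g x - f x))"
    by (intro computable_Pair computable_diff_nat assms)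
  then show ?thesis
    by (simp add: computable_def enc_prod_def enc_nat_def enc_int_def nat_minus_as_int)
qed

lemma computable_int: "computable f \<Longrightarrow> computable (\<lambda>x. int (f x))"
  using computable_int_diff[OF _ computable_const, of f 0] by simp

lemma computable_uminus_int:
  assumes "computable f"
  shows "computable (\<lambda>x. - (f x :: int))"
proof -
  have "computable (\<lambda>x. int (nat (- f x)) - int (nat (f x)))"
    by (intro computable_int_diff computable_nat computable_nat_minus assms)
  moreover have "int (nat (- i)) - int (nat i) = - i" for i :: int by simp
  ultimately show ?thesis by simp
qed

lemma computable_plus_int:
  assumes "computable f" "computable g"
  shows "computable (\<lambda>x. f x + (g x :: int))"
proof -
  have "computable (\<lambda>x. int (nat (f x) + nat (g x)) - int (nat (- f x) + nat (- g x)))"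
    by (intro computable_int_diff computable_plus_nat computable_nat computable_nat_minus assms)
  moreover have "int (nat i + nat j) - int (nat (- i) + nat (- j)) = i + j" for i j :: int by simp
  ultimately show ?thesis by simp
qed

lemma computable_diff_int:
  assumes "computable f" "computable g"
  shows "computable (\<lambda>x. f x - (g x :: int))"
  using computable_plus_int[OF assms(1) computable_uminus_int[OF assms(2)]] by simp

lemma computable_times_int:
  assumes "computable f" "computable g"
  shows "computable (\<lambda>x. f x * (g x :: int))"
proof -
  have "computable (\<lambda>x. int (nat (f x) * nat (g x) + nat (- f x) * nat (- g x)) -
      int (nat (f x) * nat (- g x) + nat (- f x) * nat (g x)))"
    by (intro computable_int_diff computable_plus_nat computable_times_nat computable_nat
        computable_nat_minus assms)
  moreover have "int (nat i * nat j + nat (- i) * nat (- j)) -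
      int (nat i * nat (- j) + nat (- i) * nat j) = i * j" for i j :: int
    by (cases "0 \<le> i"; cases "0 \<le> j") auto
  ultimately show ?thesis by simp
qed

lemma computable_pos_int:
  assumes "computable f"
  shows "computable (\<lambda>x. (0::int) < f x)"
  using computable_not[OF computable_eq_0[OF computable_nat[OF assms]]] by (simp add: not_le)

section \<open>Lists: construction, case distinction and folds\<close>

lemma computable_Cons:
  assumes "computable f" "computable g"
  shows "computable (\<lambda>x. f x # g x)"
proof -
  have "computable (\<lambda>x. Suc (enc (f x, g x)))"
    by (intro computable_Suc computable_enc computable_Pair assms)
  then show ?thesis
    by (simp add: computable_def enc_prod_def enc_nat_def)
qed

text \<open>A nonempty list is coded by the successor of the pair of head and tail. The code itself
  is thus the guard, and its predecessor is already the pair that the second branch expects.\<close>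

lemma computable_case_list:
  assumes "computable l" "computable a"
    and "computable (\<lambda>p. b (fst p) (fst (snd p)) (snd (snd p)))"
  shows "computable (\<lambda>x. case l x of [] \<Rightarrow> a x | y # ys \<Rightarrow> b x y ys)"
proof -
  obtain p q r where p: "\<And>x. rec_eval p [enc x] (enc (l x))"
    and q: "\<And>x. rec_eval q [enc x] (enc (a x))"
    and r: "\<And>x. rec_eval r [enc x] (enc (b (fst x) (fst (snd x)) (snd (snd x))))"
    using assms unfolding computable_def by blast
  have "rec_eval (rif p (RComp r [RComp rpair [RProj 0, RComp rpred [p]]]) q) [enc x]
      (enc (case l x of [] \<Rightarrow> a x | y # ys \<Rightarrow> b x y ys))" for x
  proof (rule rec_eval_rif[OF p])
    assume "enc (l x) \<noteq> 0"
    then obtain y ys where l: "l x = y # ys" by (cases "l x") auto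
    have "rec_eval (RComp rpred [p]) [enc x] (enc (y, ys))"
      using rec_eval_comp1[OF p rec_eval_rpred, of x] by (simp add: l enc_prod_def)
    from rec_eval_comp1[OF rec_eval_comp2[OF rec_eval_proj(1) this rec_eval_rpair],
        of r "enc (b x y ys)"]
    show "rec_eval (RComp r [RComp rpair [RProj 0, RComp rpred [p]]]) [enc x]
      (enc (case l x of [] \<Rightarrow> a x | y # ys \<Rightarrow> b x y ys))"
      using r[of "(x, y, ys)"] by (simp add: l enc_prod_def)
  next
    assume "enc (l x) = 0"
    then have "l x = []" by (cases "l x") auto
    then show "rec_eval q [enc x] (enc (case l x of [] \<Rightarrow> a x | y # ys \<Rightarrow> b x y ys))"
      using q[of x] by simp
  qed
  then show ?thesis by (rule computableI)
qed

lemmas computable_base =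
  computable_id computable_Pair computable_fst computable_snd computable_case_prod
  computable_if computable_Suc computable_funpow computable_plus_nat computable_diff_nat
  computable_times_nat computable_not computable_eq_nat computable_nat
  computable_int computable_uminus_int computable_plus_int computable_diff_int computable_times_int
  computable_pos_int computable_Cons computable_case_list computable_enc computable_const

lemma computable_hd:
  assumes "computable f"
  shows "computable (\<lambda>x. hd (f x))"
  unfolding hd_def by (intro computable_base assms)

lemma computable_tl:
  assumes "computable f"
  shows "computable (\<lambda>x. tl (f x))"
  unfolding tl_def by (intro computable_base assms)

text \<open>Supplies a computable number of iterations for folds before \<open>length\<close> is
  known to be computable.\<close>

lemma length_le_enc: "length l \<le> enc l"
proof (induction l)
  case (Cons x l)
  then show ?case using le_prod_encode_2[of "enc l" "enc x"] by simp
qed simp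

text \<open>One iteration consumes one list element and is idle on the empty list, so it does no
  harm that the code of the list exceeds the number of steps required.\<close>

lemma computable_foldl:
  assumes "computable (\<lambda>p. f (fst p) (fst (snd p)) (snd (snd p)))" "computable s" "computable l"
  shows "computable (\<lambda>x. foldl (f x) (s x) (l x))"
proof -
  define step where "step = (\<lambda>x p. case snd p of [] \<Rightarrow> p | y # ys \<Rightarrow> (f x (fst p) y, ys))"
  have "computable (\<lambda>x. fst ((step x ^^ enc (l x)) (s x, l x)))"
    unfolding step_def
    by (intro computable_base assms(2,3) computable_compose[OF assms(1),
        of "\<lambda>p. (fst (fst p), fst (snd (fst p)), fst (snd p))", simplified])
  moreover have "(step x ^^ n) (a, xs) = (foldl (f x) a xs, [])" if "length xs \<le> n" for x n a xs
    using that
  proof (induction n arbitrary: a xs)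
    case (Suc n)
    have "step x (a, xs) = (case xs of [] \<Rightarrow> (a, []) | y # ys \<Rightarrow> (f x a y, ys))"
      by (auto simp: step_def split: list.split)
    then show ?case
      using Suc by (cases xs) (auto simp: funpow_swap1[symmetric] simp del: funpow.simps
          simp: funpow_Suc_right)
  qed (auto simp: step_def)
  ultimately show ?thesis by (simp add: length_le_enc)
qed

lemma computable_rev:
  assumes "computable f"
  shows "computable (\<lambda>x. rev (f x))"
proof -
  have "computable (\<lambda>x. foldl (\<lambda>l y. y # l) [] (f x))"
    by (intro computable_base computable_foldl assms)
  moreover have "foldl (\<lambda>l y. y # l) ys xs = rev xs @ ys" for ys xs :: "'b list"
    by (induction xs arbitrary: ys) auto
  ultimately show ?thesis by simp
qed

lemma computable_foldr:
  assumes "computable (\<lambda>p. f (fst p) (fst (snd p)) (snd (snd p)))" "computable s" "computable l"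
  shows "computable (\<lambda>x. foldr (f x) (l x) (s x))"
  unfolding foldr_conv_foldl
  by (intro computable_foldl computable_rev computable_base assms(2,3)
      computable_compose[OF assms(1), of "\<lambda>p. (fst p, snd (snd p), fst (snd p))", simplified])

lemma computable_append:
  assumes "computable f" "computable g"
  shows "computable (\<lambda>x. f x @ g x)"
proof -
  have "computable (\<lambda>x. foldr Cons (f x) (g x))"
    by (intro computable_foldr computable_base assms)
  moreover have "foldr Cons xs ys = xs @ ys" for xs ys :: "'b list"
    by (induction xs) auto
  ultimately show ?thesis by simp
qed

lemma computable_concat:
  assumes "computable f"
  shows "computable (\<lambda>x. concat (f x))"
proof -
  have "computable (\<lambda>x. foldr append (f x) [])"
    by (intro computable_foldr computable_append computable_base assms)
  then show ?thesis by (simp add: concat_conv_foldr)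
qed

lemma computable_map:
  assumes "computable (\<lambda>p. f (fst p) (snd p))" "computable l"
  shows "computable (\<lambda>x. map (f x) (l x))"
proof -
  have "computable (\<lambda>x. foldr (\<lambda>y ys. f x y # ys) (l x) [])"
    by (intro computable_foldr computable_base assms(2)
        computable_compose[OF assms(1), of "\<lambda>p. (fst p, fst (snd p))", simplified])
  moreover have "foldr (\<lambda>y ys. g y # ys) xs [] = map g xs" for g :: "'b \<Rightarrow> 'c" and xs
    by (induction xs) auto
  ultimately show ?thesis by simp
qed

lemma computable_filter:
  assumes "computable (\<lambda>p. f (fst p) (snd p))" "computable l"
  shows "computable (\<lambda>x. filter (f x) (l x))"
proof -
  have "computable (\<lambda>x. foldr (\<lambda>y ys. if f x y then y # ys else ys) (l x) [])"
    by (intro computable_foldr computable_base assms(2)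
        computable_compose[OF assms(1), of "\<lambda>p. (fst p, fst (snd p))", simplified])
  moreover have "foldr (\<lambda>y ys. if P y then y # ys else ys) xs [] = filter P xs"
    for P and xs :: "'b list"
    by (induction xs) auto
  ultimately show ?thesis by simp
qed

lemma computable_length:
  assumes "computable l"
  shows "computable (\<lambda>x. length (l x))"
proof -
  have "computable (\<lambda>x. foldr (\<lambda>y n. Suc n) (l x) 0)"
    by (intro computable_foldr computable_base assms)
  moreover have "foldr (\<lambda>y n. Suc n) xs 0 = length xs" for xs :: "'b list"
    by (induction xs) auto
  ultimately show ?thesis by simp
qed

lemma computable_upt:
  assumes "computable n"
  shows "computable (\<lambda>x. [0..<n x])"
proof -
  have "computable (\<lambda>x. ((\<lambda>l. l @ [length l]) ^^ n x) [])"
    by (intro computable_append computable_length computable_base assms)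
  moreover have "((\<lambda>l. l @ [length l]) ^^ k) [] = [0..<k]" for k
    by (induction k) auto
  ultimately show ?thesis by simp
qed

lemma computable_replicate:
  assumes "computable n" "computable f"
  shows "computable (\<lambda>x. replicate (n x) (f x))"
proof -
  have "computable (\<lambda>x. (Cons (f x) ^^ n x) [])"
    by (intro computable_base computable_compose[OF assms(2)] assms)
  moreover have "(Cons y ^^ k) [] = replicate k y" for k and y :: 'b
    by (induction k) auto
  ultimately show ?thesis by simp
qed

lemma computable_zip:
  assumes "computable f" "computable g"
  shows "computable (\<lambda>x. zip (f x) (g x))"
proof -
  define step where "step = (\<lambda>(s :: ('b \<times> 'c) list \<times> 'c list) (y :: 'b).
    case snd s of [] \<Rightarrow> s | z # zs \<Rightarrow> (fst s @ [(y, z)], zs))"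
  have "computable (\<lambda>x. fst (foldl step ([], g x) (f x)))"
    unfolding step_def
    by (intro computable_foldl computable_append computable_base assms)
  moreover have "fst (foldl step (a, zs) ys) = a @ zip ys zs" for a ys zs
    by (induction ys arbitrary: a zs) (auto simp: step_def zip_Cons1 split: list.split)
  ultimately show ?thesis by simp
qed

section \<open>Terms: case distinction and structural recursion\<close>

lemma computable_case_mvterm:
  assumes "computable t" "computable (\<lambda>p. a (fst p) (snd p))" "computable z"
    and "computable (\<lambda>p. g (fst p) (snd p))"
    and "computable (\<lambda>p. h (fst p) (fst (snd p)) (snd (snd p)))"
  shows "computable (\<lambda>x. case t x of TVar i \<Rightarrow> a x i | TZero \<Rightarrow> z x | TNeg s \<Rightarrow> g x s
    | TPlus s u \<Rightarrow> h x s u)"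
    (is "computable ?F")
proof -
  obtain p pa pz pg ph where p: "\<And>x. rec_eval p [enc x] (enc (t x))"
    and pa: "\<And>x. rec_eval pa [enc x] (enc (a (fst x) (snd x)))"
    and pz: "\<And>x. rec_eval pz [enc x] (enc (z x))"
    and pg: "\<And>x. rec_eval pg [enc x] (enc (g (fst x) (snd x)))"
    and ph: "\<And>x. rec_eval ph [enc x] (enc (h (fst x) (fst (snd x)) (snd (snd x))))"
    using assms unfolding computable_def by blast
  define tag where "tag = (\<lambda>x. case t x of TVar i \<Rightarrow> 0 | TZero \<Rightarrow> 1 | TNeg s \<Rightarrow> 2 | TPlus s u \<Rightarrow> (3::nat))"
  define arg where "arg = (\<lambda>x. case t x of TVar i \<Rightarrow> i | TZero \<Rightarrow> 0 | TNeg s \<Rightarrow> enc s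
    | TPlus s u \<Rightarrow> prod_encode (enc s, enc u))"
  have enc_t: "enc (t x) = prod_encode (tag x, arg x)" for x
    by (cases "t x") (auto simp: tag_def arg_def)
  \<comment> \<open>The tag selects the branch by repeated predecessors. The remaining component is
    already the code of the immediate subterms, and paired with the input it is exactly what the
    branch programs expect.\<close>
  define ptag where "ptag = RComp rfst [p]"
  define parg where "parg = RComp rpair [RProj 0, RComp rsnd [p]]"
  have ptag: "rec_eval ptag [enc x] (tag x)" for x
    unfolding ptag_def using p[of x] by (auto simp: enc_t intro: rec_eval_comp1 rec_eval_rfst)
  have parg: "rec_eval parg [enc x] (prod_encode (enc x, arg x))" for x
    unfolding parg_def using p[of x]
    by (auto simp: enc_t intro: rec_eval_comp1 rec_eval_comp2 rec_eval_proj rec_eval_rsnd rec_eval_rpair)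
  have dec: "rec_eval (RComp rpred [q]) [x] (n - 1)" if "rec_eval q [x] n" for q x n
    by (rule rec_eval_comp1[OF that rec_eval_rpred])
  have "rec_eval (rif ptag (rif (RComp rpred [ptag]) (rif (RComp rpred [RComp rpred [ptag]])
      (RComp ph [parg]) (RComp pg [parg])) pz) (RComp pa [parg])) [enc x] (enc (?F x))" for x
  proof (intro rec_eval_rif ptag dec)
    show "rec_eval (RComp ph [parg]) [enc x] (enc (?F x))"
      if n: "tag x \<noteq> 0" "tag x - 1 \<noteq> 0" "tag x - 1 - 1 \<noteq> 0"
    proof -
      obtain s u where "t x = TPlus s u"
        using n by (cases "t x") (auto simp: tag_def)
      then show ?thesis
        using rec_eval_comp1[OF parg[of x], of ph] ph[of "(x, s, u)"] by (simp add: arg_def enc_prod_def)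
    qed
    show "rec_eval (RComp pg [parg]) [enc x] (enc (?F x))"
      if n: "tag x \<noteq> 0" "tag x - 1 \<noteq> 0" "tag x - 1 - 1 = 0"
    proof -
      obtain s where "t x = TNeg s"
        using n by (cases "t x") (auto simp: tag_def)
      then show ?thesis
        using rec_eval_comp1[OF parg[of x], of pg] pg[of "(x, s)"] by (simp add: arg_def enc_prod_def)
    qed
    show "rec_eval pz [enc x] (enc (?F x))" if "tag x \<noteq> 0" "tag x - 1 = 0"
    proof -
      have "t x = TZero"
        using that by (cases "t x") (auto simp: tag_def)
      then show ?thesis using pz[of x] by simp
    qed
    show "rec_eval (RComp pa [parg]) [enc x] (enc (?F x))" if n: "tag x = 0"
    proof -
      obtain i where "t x = TVar i"
        using n by (cases "t x") (auto simp: tag_def)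
      then show ?thesis
        using rec_eval_comp1[OF parg[of x], of pa] pa[of "(x, i)"]
        by (simp add: arg_def enc_prod_def enc_nat_def)
    qed
  qed (intro ptag dec)+
  then show ?thesis by (rule computableI)
qed

lemma computable_TVar: "computable f \<Longrightarrow> computable (\<lambda>x. TVar (f x))"
  using computable_enc[OF computable_Pair[OF computable_const[of "0::nat"]], of f]
  by (simp add: computable_def enc_prod_def enc_nat_def)

lemma computable_TNeg: "computable f \<Longrightarrow> computable (\<lambda>x. TNeg (f x))"
  using computable_enc[OF computable_Pair[OF computable_const[of "2::nat"]], of f]
  by (simp add: computable_def enc_prod_def enc_nat_def)

lemma computable_TPlus:
  "computable f \<Longrightarrow> computable g \<Longrightarrow> computable (\<lambda>x. TPlus (f x) (g x))"
  using computable_enc[OF computable_Pair[OF computable_const[of "3::nat"]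
        computable_Pair], of f g]
  by (simp add: computable_def enc_prod_def enc_nat_def)

lemmas computable_intros =
  computable_append computable_concat computable_map computable_filter computable_length
  computable_upt computable_replicate computable_zip computable_foldr computable_hd computable_tl
  computable_TVar computable_TNeg computable_TPlus computable_base

text \<open>Structural recursion is run on a stack machine. Its work list holds the subterms still to be
  evaluated, marked 0, and the pending connectives, marked 1 for negation and 2 for addition.\<close>

primrec eval_cost :: "mvterm \<Rightarrow> nat" where
  "eval_cost (TVar i) = 1"
| "eval_cost TZero = 1"
| "eval_cost (TNeg s) = eval_cost s + 2"
| "eval_cost (TPlus s t) = eval_cost s + eval_cost t + 2"

lemma triangle_ge: "n \<le> triangle n"
  by (induction n) auto

lemma add_le_prod_encode: "a + b \<le> prod_encode (a, b)"
  using triangle_ge[of "a + b"] by (simp add: prod_encode_def)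

text \<open>The exact cost is itself defined by recursion on terms, the very scheme to be shown
  computable. A bound read off the code breaks this circle, since surplus steps are idle.\<close>

lemma eval_cost_le: "eval_cost t \<le> 2 * enc t + 1"
proof (induction t)
  case (TNeg s)
  then show ?case using add_le_prod_encode[of 2 "enc s"] by simp
next
  case (TPlus s t)
  then show ?case
    using add_le_prod_encode[of 3 "prod_encode (enc s, enc t)"] add_le_prod_encode[of "enc s" "enc t"]
    by simp
qed auto

lemma computable_mvterm_recursion:
  fixes F :: "'e::encodable \<Rightarrow> mvterm \<Rightarrow> 'b::encodable"
  assumes F: "\<And>e i. F e (TVar i) = a e i" "\<And>e. F e TZero = z e"
    "\<And>e s. F e (TNeg s) = g e (F e s)" "\<And>e s t. F e (TPlus s t) = h e (F e s) (F e t)"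
    and comp: "computable (\<lambda>p. a (fst p) (snd p))" "computable z"
    "computable (\<lambda>p. g (fst p) (snd p))"
    "computable (\<lambda>p. h (fst p) (fst (snd p)) (snd (snd p)))"
    and e: "computable e" and t: "computable t"
  shows "computable (\<lambda>x. F (e x) (t x))"
proof -
  \<comment> \<open>The \<open>TZero\<close> next to the marks 1 and 2 is only a filler. The right
    summand is evaluated last, so its value lies above that of the left one; hence the order of the
    arguments of \<open>h\<close>.\<close>
  define step where "step = (\<lambda>e (p :: (nat \<times> mvterm) list \<times> 'b list).
    case fst p of [] \<Rightarrow> p | w # ws \<Rightarrow>
      if fst w = 0 then
        (case snd w of TVar i \<Rightarrow> (ws, a e i # snd p) | TZero \<Rightarrow> (ws, z e # snd p)
         | TNeg s \<Rightarrow> ((0, s) # (1, TZero) # ws, snd p)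
         | TPlus s t \<Rightarrow> ((0, s) # (0, t) # (2, TZero) # ws, snd p))
      else if fst w = 1 then (ws, g e (hd (snd p)) # tl (snd p))
      else (ws, h e (hd (tl (snd p))) (hd (snd p)) # tl (tl (snd p))))"
  have step: "computable (\<lambda>p. step (fst p) (snd p))"
    unfolding step_def
    by (intro computable_case_mvterm computable_intros computable_eq_nat
        computable_apply2[OF comp(1)] computable_compose[OF comp(2)] computable_apply2[OF comp(3)]
        computable_compose[OF comp(4), of "\<lambda>p. (_ p, _ p, _ p)", simplified])
  have run: "(step e ^^ eval_cost t) ((0, t) # ws, st) = (ws, F e t # st)" for e t ws st
  proof (induction t arbitrary: ws st)
    case (TNeg s)
    have "(step e ^^ eval_cost (TNeg s)) ((0, TNeg s) # ws, st) =
        step e ((step e ^^ eval_cost s) (step e ((0, TNeg s) # ws, st)))"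
      by (simp add: funpow_swap1)
    then show ?case
      using TNeg by (simp add: step_def F)
  next
    case (TPlus s t)
    have "(step e ^^ eval_cost (TPlus s t)) ((0, TPlus s t) # ws, st) =
        step e ((step e ^^ eval_cost t) ((step e ^^ eval_cost s) (step e ((0, TPlus s t) # ws, st))))"
      by (simp add: funpow_swap1 funpow_add add.commute[of "eval_cost s"])
    then show ?case
      using TPlus by (simp add: step_def F)
  qed (simp_all add: step_def F)
  have halt: "(step e ^^ k) ([], st) = ([], st)" for e k st
    by (induction k) (auto simp: step_def)
  have F_eq: "hd (snd ((step e ^^ Suc (2 * enc t)) ([(0, t)], []))) = F e t" for e t
  proof -
    obtain k where "Suc (2 * enc t) = k + eval_cost t"
      using eval_cost_le[of t] by (metis Suc_eq_plus1 le_add_diff_inverse2)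
    then show ?thesis
      by (simp only: funpow_add o_apply run halt) simp
  qed
  have "computable (\<lambda>x. hd (snd ((step (e x) ^^ Suc (2 * enc (t x))) ([(0, t x)], []))))"
    by (intro computable_intros computable_apply2[OF step] computable_compose[OF e] t)
  then show ?thesis by (simp only: F_eq)
qed


section \<open>Projection of polyhedra\<close>

fun lin :: "int list \<Rightarrow> real list \<Rightarrow> real" where
  "lin (a # p) (x # v) = of_int a * x + lin p v"
| "lin _ _ = 0"

definition holds :: "int list list \<Rightarrow> real list \<Rightarrow> bool" where
  "holds C v \<longleftrightarrow> (\<forall>p\<in>set C. 0 \<le> lin p v)"

definition sat :: "int list list list \<Rightarrow> real list \<Rightarrow> bool" where
  "sat D v \<longleftrightarrow> (\<exists>C\<in>set D. holds C v)"

definition lincomb :: "int \<Rightarrow> int list \<Rightarrow> int \<Rightarrow> int list \<Rightarrow> int list" where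
  "lincomb a p b q = map (\<lambda>(x, y). a * x + b * y) (zip p q)"

definition unit_form :: "nat \<Rightarrow> nat \<Rightarrow> int list" where
  "unit_form N i = map (\<lambda>j. if j = i then 1 else 0) [0..<N]"

lemma holds_simps [simp]:
  "holds [] v"
  "holds (p # C) v \<longleftrightarrow> 0 \<le> lin p v \<and> holds C v"
  "holds (C @ C') v \<longleftrightarrow> holds C v \<and> holds C' v"
  by (auto simp: holds_def)

lemma length_lincomb [simp]: "length (lincomb a p b q) = min (length p) (length q)"
  by (simp add: lincomb_def)

lemma length_unit_form [simp]: "length (unit_form N i) = N"
  by (simp add: unit_form_def)

lemma lin_lincomb [simp]:
  "length p = length q \<Longrightarrow> lin (lincomb a p b q) v = of_int a * lin p v + of_int b * lin q v"
proof (induction p q arbitrary: v rule: list_induct2)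
  case (Cons x p y q)
  then show ?case by (cases v) (auto simp: lincomb_def algebra_simps)
qed (simp add: lincomb_def)

lemma lin_uminus [simp]: "lin (map uminus p) v = - lin p v"
  by (induction p v rule: lin.induct) auto

lemma lin_replicate_0 [simp]: "lin (replicate n 0) v = 0"
proof (induction n arbitrary: v)
  case (Suc n)
  then show ?case by (cases v) auto
qed simp

lemma lin_append: "length p = length v \<Longrightarrow> lin (p @ q) (v @ w) = lin p v + lin q w"
  by (induction p v rule: list_induct2) auto

lemma lin_conv_sum: "length p = length v \<Longrightarrow> lin p v = (\<Sum>i<length v. of_int (p ! i) * v ! i)"
  by (induction p v rule: list_induct2) (simp_all add: sum.lessThan_Suc_shift del: sum.lessThan_Suc)

lemma lin_unit_form [simp]:
  assumes "length v = N" "i < N"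
  shows "lin (unit_form N i) v = v ! i"
proof -
  have "lin (unit_form N i) v = (\<Sum>j<N. of_int (unit_form N i ! j) * v ! j)"
    using assms by (simp add: lin_conv_sum)
  also have "\<dots> = (\<Sum>j<N. (if j = i then v ! i else 0))"
    by (intro sum.cong) (auto simp: unit_form_def)
  finally have "lin (unit_form N i) v = (\<Sum>j<N. (if j = i then v ! i else 0))" .
  then show ?thesis using assms by simp
qed

lemma lin_hd_tl: "p \<noteq> [] \<Longrightarrow> lin p (x # v) = of_int (hd p) * x + lin (tl p) v"
  by (cases p) auto

text \<open>If \<open>x \<ge> 0\<close> satisfies \<open>C\<close>, so does the largest of 0 and the lower bounds that \<open>C\<close> imposes on
  \<open>x\<close>, hence only 0 and the roots of forms with positive leading coefficient need to be tried.\<close>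

definition elim_conj :: "int list list \<Rightarrow> int list list list" where
  "elim_conj C = map tl C #
     map (\<lambda>p. map uminus (tl p) # map (\<lambda>q. tl (lincomb (hd p) q (- hd q) p)) C)
       (filter (\<lambda>p. 0 < hd p) C)"

definition elim :: "int list list list \<Rightarrow> int list list list" where
  "elim D = concat (map elim_conj D)"

lemma lin_tl_lincomb:
  assumes "length p = Suc (length v)" "length q = Suc (length v)"
  shows "lin (tl (lincomb (hd p) q (- hd q) p)) v =
    of_int (hd p) * lin (tl q) v - of_int (hd q) * lin (tl p) v"
proof -
  have "tl (lincomb a q b p) = lincomb a (tl q) b (tl p)" for a b
    using assms by (cases p; cases q) (auto simp: lincomb_def)
  then show ?thesis using assms by simp
qed

lemma sat_elim_conj:
  assumes len: "\<And>p. p \<in> set C \<Longrightarrow> length p = Suc (length v)"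
  shows "sat (elim_conj C) v \<longleftrightarrow> (\<exists>x\<ge>0. holds C (x # v))"
proof
  have lin_Cons: "lin q (x # v) = of_int (hd q) * x + lin (tl q) v" if "q \<in> set C" for q x
    using len[OF that] by (intro lin_hd_tl) auto
  \<comment> \<open>Substituting the root of \<open>p\<close> into \<open>q\<close> and multiplying
    by the positive number \<open>hd p\<close> clears the denominator, which keeps the coefficients
    integral and the sign unchanged.\<close>
  have root: "holds (map (\<lambda>q. tl (lincomb (hd p) q (- hd q) p)) C) v \<longleftrightarrow>
      holds C (- lin (tl p) v / of_int (hd p) # v)" if "p \<in> set C" "0 < hd p" for p
  proof -
    have "0 \<le> lin (tl (lincomb (hd p) q (- hd q) p)) v \<longleftrightarrow>
        0 \<le> lin q (- lin (tl p) v / of_int (hd p) # v)" if "q \<in> set C" for q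
    proof -
      have "lin (tl (lincomb (hd p) q (- hd q) p)) v =
          of_int (hd p) * lin q (- lin (tl p) v / of_int (hd p) # v)"
        using \<open>0 < hd p\<close> \<open>p \<in> set C\<close> that
        by (simp add: lin_tl_lincomb len lin_Cons field_simps)
      then show ?thesis
        using \<open>0 < hd p\<close> by (simp add: zero_le_mult_iff)
    qed
    then show ?thesis by (auto simp: holds_def)
  qed
  {
    assume "sat (elim_conj C) v"
    then consider "holds (map tl C) v"
      | p where "p \<in> set C" "0 < hd p" "0 \<le> - lin (tl p) v"
        "holds (map (\<lambda>q. tl (lincomb (hd p) q (- hd q) p)) C) v"
      by (auto simp: sat_def elim_conj_def)
    then show "\<exists>x\<ge>0. holds C (x # v)"
    proof cases
      case 1
      then have "holds C (0 # v)" by (auto simp: holds_def lin_Cons)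
      then show ?thesis by auto
    next
      case 2
      then have "0 \<le> - lin (tl p) v / of_int (hd p)"
        by (intro divide_nonneg_pos) auto
      then show ?thesis using 2 root by blast
    qed
  next
    assume "\<exists>x\<ge>0. holds C (x # v)"
    then obtain x where x: "0 \<le> x" and hx: "\<And>q. q \<in> set C \<Longrightarrow> 0 \<le> of_int (hd q) * x + lin (tl q) v"
      by (auto simp: holds_def lin_Cons)
    \<comment> \<open>These are the forms whose lower bound on \<open>x\<close> is strictly
      positive; the other lower bounds are implied by nonnegativity.\<close>
    define P where "P = {p \<in> set C. 0 < hd p \<and> lin (tl p) v < 0}"
    define r where "r = (\<lambda>p. - lin (tl p) v / of_int (hd p))"
    \<comment> \<open>Forms of this kind bound \<open>x\<close> from above or do not depend on it,
      so they survive when \<open>x\<close> is lowered to the candidate.\<close>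
    have nonpos: "0 \<le> of_int (hd q) * x' + lin (tl q) v" if "q \<in> set C" "hd q \<le> 0" "x' \<le> x" for q x'
    proof -
      have "of_int (hd q) * x \<le> of_int (hd q) * x'"
        using that by (intro mult_left_mono_neg) auto
      then show ?thesis using hx[OF that(1)] by linarith
    qed
    show "sat (elim_conj C) v"
    proof (cases "P = {}")
      case True
      have "0 \<le> lin (tl q) v" if "q \<in> set C" for q
        using nonpos[OF that _ x] True that by (cases "0 < hd q") (auto simp: P_def)
      then show ?thesis by (auto simp: sat_def elim_conj_def holds_def)
    next
      case False
      have fin: "finite (r ` P)" by (simp add: P_def)
      then obtain p where "p \<in> P" "r p = Max (r ` P)"
        by (metis (no_types, lifting) False Max_in imageE image_is_empty)
      with fin have p: "p \<in> P" "\<And>q. q \<in> P \<Longrightarrow> r q \<le> r p" by auto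
      then have pC: "p \<in> set C" "0 < hd p" "lin (tl p) v < 0" by (auto simp: P_def)
      have rp: "0 < r p" "r p \<le> x"
        using pC hx[OF pC(1)] by (auto simp: r_def field_simps)
      have "0 \<le> lin q (r p # v)" if q: "q \<in> set C" for q
      proof (cases "0 < hd q")
        case False
        then show ?thesis using nonpos[OF q _ rp(2)] by (simp add: lin_Cons q)
      next
        case True
        show ?thesis
        proof (cases "q \<in> P")
          case inP: True
          have "- lin (tl q) v = r q * of_int (hd q)"
            using True by (simp add: r_def)
          also have "\<dots> \<le> r p * of_int (hd q)"
            using p(2)[OF inP] True by (intro mult_right_mono) auto
          finally have "- lin (tl q) v \<le> r p * of_int (hd q)" .
          then show ?thesis by (simp add: lin_Cons q mult.commute)
        next
          case False
          then have "0 \<le> lin (tl q) v" using True q by (auto simp: P_def)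
          then show ?thesis using True rp by (simp add: lin_Cons q)
        qed
      qed
      then have "holds C (r p # v)" by (simp add: holds_def)
      then show ?thesis
        using root[OF pC(1,2)] pC by (auto simp: sat_def elim_conj_def r_def)
    qed
  }
qed

definition forms_of_length :: "nat \<Rightarrow> int list list list \<Rightarrow> bool" where
  "forms_of_length k D \<longleftrightarrow> (\<forall>C\<in>set D. \<forall>p\<in>set C. length p = k)"

lemma sat_elim:
  assumes "forms_of_length (Suc (length v)) D"
  shows "sat (elim D) v \<longleftrightarrow> (\<exists>x\<ge>0. sat D (x # v))"
proof -
  have "sat (elim D) v \<longleftrightarrow> (\<exists>C\<in>set D. sat (elim_conj C) v)"
    by (auto simp: elim_def sat_def)
  also have "\<dots> \<longleftrightarrow> (\<exists>C\<in>set D. \<exists>x\<ge>0. holds C (x # v))"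
    using assms by (intro bex_cong refl sat_elim_conj) (auto simp: forms_of_length_def)
  finally show ?thesis by (auto simp: sat_def)
qed

lemma forms_of_length_elim: "forms_of_length (Suc k) D \<Longrightarrow> forms_of_length k (elim D)"
  by (auto simp: forms_of_length_def elim_def elim_conj_def)

lemma forms_of_length_elim_funpow:
  "forms_of_length (n + k) D \<Longrightarrow> forms_of_length k ((elim ^^ n) D)"
  by (induction n arbitrary: D)
    (auto simp: funpow_Suc_right forms_of_length_elim simp del: funpow.simps(2))

lemma sat_elim_funpow:
  assumes "forms_of_length (n + length v) D"
  shows "sat ((elim ^^ n) D) v \<longleftrightarrow> (\<exists>xs. length xs = n \<and> (\<forall>x\<in>set xs. 0 \<le> x) \<and> sat D (xs @ v))"
  using assms
proof (induction n arbitrary: D)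
  case (Suc n)
  have "sat ((elim ^^ Suc n) D) v \<longleftrightarrow>
      (\<exists>xs. length xs = n \<and> (\<forall>x\<in>set xs. 0 \<le> x) \<and> sat (elim D) (xs @ v))"
    using Suc by (simp add: funpow_Suc_right forms_of_length_elim del: funpow.simps(2))
  also have "\<dots> \<longleftrightarrow> (\<exists>xs. length xs = n \<and> (\<forall>x\<in>set xs. 0 \<le> x) \<and> (\<exists>x\<ge>0. sat D (x # xs @ v)))"
    using Suc.prems by (intro ex_cong1 conj_cong refl sat_elim) (simp add: add.commute)
  also have "\<dots> \<longleftrightarrow> (\<exists>xs. length xs = Suc n \<and> (\<forall>x\<in>set xs. 0 \<le> x) \<and> sat D (xs @ v))"
  proof safe
    fix xs and x :: real
    assume "n = length xs" "\<forall>x\<in>set xs. 0 \<le> x" "0 \<le> x" "sat D (x # xs @ v)"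
    then show "\<exists>ys. length ys = Suc (length xs) \<and> (\<forall>x\<in>set ys. 0 \<le> x) \<and> sat D (ys @ v)"
      by (intro exI[of _ "x # xs"]) auto
  next
    fix xs assume xs: "length xs = Suc n" "\<forall>x\<in>set xs. 0 \<le> x" "sat D (xs @ v)"
    then show "\<exists>xs. length xs = n \<and> (\<forall>x\<in>set xs. 0 \<le> x) \<and> (\<exists>x\<ge>0. sat D (x # xs @ v))"
      by (intro exI[of _ "tl xs"]) (cases xs; auto)
  qed
  finally show ?case .
qed simp


section \<open>Terms as piecewise linear functions\<close>

primrec teval :: "mvterm \<Rightarrow> (nat \<Rightarrow> real) \<Rightarrow> real" where
  "teval (TVar i) x = x i"
| "teval TZero x = 0"
| "teval (TNeg s) x = 1 - teval s x"
| "teval (TPlus s t) x = min 1 (teval s x + teval t x)"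

lemma teval_bounds:
  assumes "\<And>i. i \<in> term_vars t \<Longrightarrow> 0 \<le> x i \<and> x i \<le> 1"
  shows "0 \<le> teval t x" "teval t x \<le> 1"
  using assms by (induction t) auto

lemma teval_cong: "(\<And>i. i \<in> term_vars t \<Longrightarrow> x i = y i) \<Longrightarrow> teval t x = teval t y"
  by (induction t) auto

text \<open>Forms are homogeneous, with \<open>N\<close> coefficients: coordinate \<open>k\<close> plays the role of the constant 1.
  A piece \<open>(C, p)\<close> says that the term has the value \<open>p\<close> where \<open>C\<close> holds.\<close>

definition plus_pieces :: "int list \<Rightarrow> int list list \<times> int list \<Rightarrow> int list list \<times> int list \<Rightarrow>
    (int list list \<times> int list) list" where
  "plus_pieces one P Q =
     (let s = lincomb 1 (snd P) 1 (snd Q); d = lincomb 1 one (- 1) s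
      in [(d # fst P @ fst Q, s), (map uminus d # fst P @ fst Q, one)])"

primrec pieces :: "nat \<Rightarrow> nat \<Rightarrow> mvterm \<Rightarrow> (int list list \<times> int list) list" where
  "pieces N k (TVar i) = [([], unit_form N i)]"
| "pieces N k TZero = [([], replicate N 0)]"
| "pieces N k (TNeg s) =
     map (\<lambda>P. (fst P, lincomb 1 (unit_form N k) (- 1) (snd P))) (pieces N k s)"
| "pieces N k (TPlus s t) = concat (map (\<lambda>P. concat (map (plus_pieces (unit_form N k) P)
     (pieces N k t))) (pieces N k s))"

lemma length_pieces:
  "P \<in> set (pieces N k t) \<Longrightarrow> length (snd P) = N \<and> (\<forall>q\<in>set (fst P). length q = N)"
proof (induction t arbitrary: P)
  case (TPlus s t)
  then obtain P1 P2 where P: "P1 \<in> set (pieces N k s)" "P2 \<in> set (pieces N k t)"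
    "P \<in> set (plus_pieces (unit_form N k) P1 P2)"
    by auto
  then show ?case
    using TPlus.IH(1)[OF P(1)] TPlus.IH(2)[OF P(2)] by (auto simp: plus_pieces_def Let_def)
qed auto

text \<open>The vector \<open>v\<close> is the point \<open>x\<close> scaled by
  \<open>v ! k\<close>, so a homogeneous form yields the scaled value, and a nonnegative scale
  passes through the minimum. The scale may be 0, which is why \<open>x\<close> is given and not
  obtained by division. Regions of pieces overlap; the second claim says that all applicable pieces
  agree, which makes the graph description exact.\<close>

lemma pieces_correct:
  assumes v: "length v = N" "k < N" "0 \<le> v ! k" "\<And>i. i \<in> term_vars t \<Longrightarrow> i < N \<and> v ! i = v ! k * x i"
  shows "\<exists>P\<in>set (pieces N k t). holds (fst P) v"
    and "P \<in> set (pieces N k t) \<Longrightarrow> holds (fst P) v \<Longrightarrow> lin (snd P) v = v ! k * teval t x"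
proof -
  have "(\<exists>P\<in>set (pieces N k t). holds (fst P) v) \<and>
    (\<forall>P\<in>set (pieces N k t). holds (fst P) v \<longrightarrow> lin (snd P) v = v ! k * teval t x)"
    using v(4)
  proof (induction t)
    case (TNeg s)
    then show ?case
      using v by (auto simp: length_pieces algebra_simps)
  next
    case (TPlus s t)
    have plus: "lin (snd P) v = v ! k * teval (TPlus s t) x"
      if P: "P1 \<in> set (pieces N k s)" "P2 \<in> set (pieces N k t)"
        "P \<in> set (plus_pieces (unit_form N k) P1 P2)" "holds (fst P) v" for P P1 P2
    proof -
      have 1: "lin (snd P1) v = v ! k * teval s x" "lin (snd P2) v = v ! k * teval t x"
        using P TPlus by (auto simp: plus_pieces_def Let_def)
      have "v ! k * min 1 a = min (v ! k) (v ! k * a)" for a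
        using v(3) by (simp add: min_mult_distrib_left)
      then show ?thesis
        using P v 1 length_pieces[OF P(1)] length_pieces[OF P(2)]
        by (auto simp: plus_pieces_def Let_def algebra_simps)
    qed
    obtain P1 P2 where P: "P1 \<in> set (pieces N k s)" "holds (fst P1) v"
      "P2 \<in> set (pieces N k t)" "holds (fst P2) v"
      using TPlus by auto
    have "\<exists>P\<in>set (plus_pieces (unit_form N k) P1 P2). holds (fst P) v"
      using P by (auto simp: plus_pieces_def Let_def)
    then have "\<exists>P\<in>set (pieces N k (TPlus s t)). holds (fst P) v"
      using P by auto
    with plus show ?case by auto
  qed (use v in auto)
  then show "\<exists>P\<in>set (pieces N k t). holds (fst P) v"
    and "P \<in> set (pieces N k t) \<Longrightarrow> holds (fst P) v \<Longrightarrow> lin (snd P) v = v ! k * teval t x"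
    by auto
qed

text \<open>Coordinates are listed as \<open>x @ 1 # y\<close>, with \<open>x\<close> in the domain and \<open>y\<close> in the range.\<close>

definition dnf_conj :: "int list list list \<Rightarrow> int list list list \<Rightarrow> int list list list" where
  "dnf_conj D D' = concat (map (\<lambda>C. map (\<lambda>C'. C @ C') D') D)"

definition graph_dnf :: "nat \<Rightarrow> nat \<Rightarrow> nat \<Rightarrow> mvterm \<Rightarrow> int list list list" where
  "graph_dnf N n j t = map (\<lambda>P. lincomb 1 (snd P) (- 1) (unit_form N j) #
      lincomb (- 1) (snd P) 1 (unit_form N j) # fst P) (pieces N n t)"

text \<open>Only upper bounds are imposed: the bounds from below come from the elimination, which
  ranges over nonnegative values.\<close>

definition upper_bounds :: "nat \<Rightarrow> nat \<Rightarrow> int list list" where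
  "upper_bounds N n = map (\<lambda>j. lincomb 1 (unit_form N n) (- 1) (unit_form N j)) [0..<n]"

text \<open>The unit sits at index \<open>n\<close>, hence output \<open>j\<close> has index
  \<open>Suc n + j\<close>. Elimination strips coordinates from the front, so exactly the domain
  coordinates disappear.\<close>

definition range_dnf :: "nat \<Rightarrow> mvterm list \<Rightarrow> int list list list" where
  "range_dnf n ts = (elim ^^ n)
     (foldr (\<lambda>p. dnf_conj (graph_dnf (Suc n + length ts) n (Suc n + fst p) (snd p)))
       (zip [0..<length ts] ts) [upper_bounds (Suc n + length ts) n])"

lemma sat_dnf_conj: "sat (dnf_conj D D') v \<longleftrightarrow> sat D v \<and> sat D' v"
  by (auto simp: sat_def dnf_conj_def)

lemma forms_of_length_dnf_conj:
  "forms_of_length k D \<Longrightarrow> forms_of_length k D' \<Longrightarrow> forms_of_length k (dnf_conj D D')"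
  by (auto simp: forms_of_length_def dnf_conj_def)

lemma forms_of_length_graph_dnf: "forms_of_length N (graph_dnf N n j t)"
  by (auto simp: forms_of_length_def graph_dnf_def length_pieces)

lemma forms_of_length_upper_bounds: "forms_of_length N [upper_bounds N n]"
  by (auto simp: forms_of_length_def upper_bounds_def)

lemma holds_upper_bounds:
  assumes "length v = N" "n < N"
  shows "holds (upper_bounds N n) v \<longleftrightarrow> (\<forall>j<n. v ! j \<le> v ! n)"
  using assms by (auto simp: holds_def upper_bounds_def)

lemma sat_graph_dnf:
  assumes "length v = N" "n < N" "j < N" "0 \<le> v ! n" "\<And>i. i \<in> term_vars t \<Longrightarrow> i < N \<and> v ! i = v ! n * x i"
  shows "sat (graph_dnf N n j t) v \<longleftrightarrow> v ! j = v ! n * teval t x"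
proof -
  have "sat (graph_dnf N n j t) v \<longleftrightarrow> (\<exists>P\<in>set (pieces N n t). lin (snd P) v = v ! j \<and> holds (fst P) v)"
    using assms by (auto simp: sat_def graph_dnf_def length_pieces intro!: bex_cong)
  also have "\<dots> \<longleftrightarrow> v ! j = v ! n * teval t x"
    using pieces_correct[where x = x and t = t, OF assms(1,2,4,5)] by metis
  finally show ?thesis .
qed

lemma forms_of_length_range_dnf: "forms_of_length (Suc (length ts)) (range_dnf n ts)"
proof -
  have "forms_of_length N (foldr (\<lambda>p. dnf_conj (graph_dnf N n (Suc n + fst p) (snd p)))
      ps [upper_bounds N n])" for N and ps :: "(nat \<times> mvterm) list"
    by (induction ps)
      (auto simp: forms_of_length_upper_bounds intro!: forms_of_length_dnf_conj forms_of_length_graph_dnf)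
  from this[of "Suc n + length ts"] show ?thesis
    unfolding range_dnf_def by (intro forms_of_length_elim_funpow) simp
qed

lemma sat_range_dnf:
  assumes vars: "\<And>t. t \<in> set ts \<Longrightarrow> term_vars t \<subseteq> {..<n}" and y: "length y = length ts"
  shows "sat (range_dnf n ts) (1 # y) \<longleftrightarrow>
    (\<exists>x. (\<forall>i<n. 0 \<le> x i \<and> x i \<le> 1) \<and> (\<forall>j<length ts. y ! j = teval (ts ! j) x))"
proof -
  define N where "N = Suc n + length ts"
  define D where "D = (\<lambda>ps. foldr (\<lambda>p. dnf_conj (graph_dnf N n (Suc n + fst p) (snd p)))
      ps [upper_bounds N n])"
  have fol: "forms_of_length N (D ps)" for ps :: "(nat \<times> mvterm) list"
    unfolding D_def
    by (induction ps)
      (auto simp: forms_of_length_upper_bounds intro!: forms_of_length_dnf_conj forms_of_length_graph_dnf)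
  have sat_D: "sat (D ps) (xs @ 1 # y) \<longleftrightarrow>
      (\<forall>x\<in>set xs. x \<le> 1) \<and> (\<forall>p\<in>set ps. y ! fst p = teval (snd p) ((!) xs))"
    if xs: "length xs = n" and ps: "set ps \<subseteq> set (zip [0..<length ts] ts)" for xs ps
    using ps
  proof (induction ps)
    case Nil
    then show ?case
      using xs y by (auto simp: D_def sat_def holds_upper_bounds N_def nth_append all_set_conv_all_nth)
  next
    case (Cons p ps)
    then have "p \<in> set (zip [0..<length ts] ts)" by simp
    then obtain j where j: "j < length ts" "p = (j, ts ! j)"
      by (auto simp: in_set_zip prod_eq_iff)
    have "sat (graph_dnf N n (Suc n + j) (ts ! j)) (xs @ 1 # y) \<longleftrightarrow>
        (xs @ 1 # y) ! (Suc n + j) = (xs @ 1 # y) ! n * teval (ts ! j) ((!) xs)"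
      using j xs y vars[OF nth_mem[OF j(1)]]
      by (intro sat_graph_dnf) (auto simp: N_def nth_append)
    then show ?case
      using Cons j xs by (auto simp: D_def sat_dnf_conj nth_append)
  qed
  have "sat (range_dnf n ts) (1 # y) \<longleftrightarrow> (\<exists>xs. length xs = n \<and> (\<forall>x\<in>set xs. 0 \<le> x) \<and>
      sat (D (zip [0..<length ts] ts)) (xs @ 1 # y))"
  proof -
    have "range_dnf n ts = (elim ^^ n) (D (zip [0..<length ts] ts))"
      by (simp add: range_dnf_def D_def N_def)
    then show ?thesis
      using fol[of "zip [0..<length ts] ts"] y by (simp add: sat_elim_funpow N_def)
  qed
  also have "\<dots> \<longleftrightarrow> (\<exists>xs. length xs = n \<and> (\<forall>i<n. 0 \<le> xs ! i \<and> xs ! i \<le> 1) \<and>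
      (\<forall>j<length ts. y ! j = teval (ts ! j) ((!) xs)))"
    by (intro ex_cong1) (auto simp: sat_D all_set_conv_all_nth)
  also have "\<dots> \<longleftrightarrow>
    (\<exists>x. (\<forall>i<n. 0 \<le> x i \<and> x i \<le> 1) \<and> (\<forall>j<length ts. y ! j = teval (ts ! j) x))"
  proof safe
    fix x assume x: "\<forall>i<n. 0 \<le> x i \<and> x i \<le> 1" "\<forall>j<length ts. y ! j = teval (ts ! j) x"
    have "teval (ts ! j) ((!) (map x [0..<n])) = teval (ts ! j) x" if "j < length ts" for j
      using vars[OF nth_mem[OF that]] by (intro teval_cong) auto
    with x show "\<exists>xs. length xs = n \<and> (\<forall>i<n. 0 \<le> xs ! i \<and> xs ! i \<le> 1) \<and>
      (\<forall>j<length ts. y ! j = teval (ts ! j) ((!) xs))"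
      by (intro exI[of _ "map x [0..<n]"]) auto
  qed blast
  finally show ?thesis .
qed


section \<open>Terms with a prescribed zero set\<close>

definition clamp :: "real \<Rightarrow> real" where
  "clamp r = max 0 (min 1 r)"

text \<open>The join of an MV-algebra, \<open>(s \<ominus> t) \<oplus> t\<close>; the meet below is
  its De Morgan dual.\<close>

definition tmax :: "mvterm \<Rightarrow> mvterm \<Rightarrow> mvterm" where
  "tmax s t = TPlus (TNeg (TPlus (TNeg s) t)) t"

definition tmin :: "mvterm \<Rightarrow> mvterm \<Rightarrow> mvterm" where
  "tmin s t = TNeg (tmax (TNeg s) (TNeg t))"

lemma term_vars_tmax [simp]: "term_vars (tmax s t) = term_vars s \<union> term_vars t"
  by (auto simp: tmax_def)

lemma term_vars_tmin [simp]: "term_vars (tmin s t) = term_vars s \<union> term_vars t"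
  by (auto simp: tmin_def)

lemma teval_tmax: "teval s x \<le> 1 \<Longrightarrow> teval t x \<le> 1 \<Longrightarrow> teval (tmax s t) x = max (teval s x) (teval t x)"
  by (auto simp: tmax_def)

lemma teval_tmin: "0 \<le> teval s x \<Longrightarrow> 0 \<le> teval t x \<Longrightarrow> teval (tmin s t) x = min (teval s x) (teval t x)"
  by (auto simp: tmin_def teval_tmax)

text \<open>The Rose-Rosser recursion: if \<open>x \<in> [0,1]\<close>, then \<open>clamp (r + x)\<close> is obtained from
  \<open>clamp r \<oplus> x\<close> and \<open>clamp (r + 1)\<close> by the Lukasiewicz conjunction. To avoid branching, the
  terms for \<open>r, r + 1, r + 2, \<dots>\<close> are computed together; each literal shortens the list by one.\<close>

definition shift_add :: "mvterm \<Rightarrow> mvterm list \<Rightarrow> mvterm list" where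
  "shift_add l L = map (\<lambda>(s, t). TNeg (TPlus (TNeg (TPlus s l)) (TNeg t))) (zip L (tl L))"

text \<open>A negative coefficient is moved to the negated variable by
  \<open>a * x = \<bar>a\<bar> * (1 - x) - \<bar>a\<bar>\<close>, so that only summands in
  \<open>[0,1]\<close> are added. The constants split off in this way are collected in
  \<open>neg_sum\<close>.\<close>

definition literals :: "int list \<Rightarrow> mvterm list" where
  "literals p = concat (map (\<lambda>(i, a). replicate (nat a) (TVar i) @ replicate (nat (- a)) (TNeg (TVar i)))
     (zip [0..<length p] p))"

definition neg_sum :: "int list \<Rightarrow> int" where
  "neg_sum p = foldr (\<lambda>a s. int (nat (- a)) + s) p 0"

text \<open>The head of \<open>p\<close> is its constant coefficient. After the correction by
  \<open>neg_sum\<close> the starting values are integers, whose clamped values are the constants 0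
  and 1. One more entry than there are literals is provided, so exactly one survives.\<close>

definition clamp_term :: "int list \<Rightarrow> mvterm" where
  "clamp_term p = hd (foldr shift_add (literals (tl p))
     (map (\<lambda>j. if 0 < hd p - neg_sum (tl p) + int j then TNeg TZero else TZero)
       [0..<Suc (length (literals (tl p)))]))"

text \<open>For \<open>r \<ge> 0\<close> the factor \<open>clamp (r + 1)\<close> is 1 and truncated
  addition is correct. For \<open>r \<le> -1\<close> both sides are 0. In between,
  \<open>clamp r\<close> is 0 and \<open>clamp (r + 1)\<close> is \<open>r + 1\<close>, and its
  conjunction with \<open>x\<close> is \<open>max 0 (r + x)\<close>.\<close>

lemma clamp_add:
  assumes "0 \<le> x" "x \<le> 1"
  shows "clamp (r + x) = 1 - min 1 ((1 - min 1 (clamp r + x)) + (1 - clamp (r + 1)))"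
  using assms unfolding clamp_def max_def min_def by (smt (verit))

lemma length_shift_add [simp]: "length (shift_add l L) = length L - 1"
  by (simp add: shift_add_def)

lemma nth_shift_add:
  assumes "Suc j < length L"
  shows "shift_add l L ! j = TNeg (TPlus (TNeg (TPlus (L ! j) l)) (TNeg (L ! Suc j)))"
  using assms by (simp add: shift_add_def nth_tl)

lemma length_foldr_shift_add [simp]: "length (foldr shift_add ls L) = length L - length ls"
  by (induction ls) auto

lemma teval_foldr_shift_add:
  assumes "\<And>l. l \<in> set ls \<Longrightarrow> 0 \<le> teval l x \<and> teval l x \<le> 1"
    and "\<And>j. j < length L \<Longrightarrow> teval (L ! j) x = clamp (r + real j)"
    and "j < length L - length ls"
  shows "teval (foldr shift_add ls L ! j) x = clamp (r + (\<Sum>l\<leftarrow>ls. teval l x) + real j)"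
  using assms(1,3)
proof (induction ls arbitrary: j)
  case (Cons l ls)
  let ?s = "\<Sum>l\<leftarrow>ls. teval l x"
  have "teval (foldr shift_add (l # ls) L ! j) x = clamp (r + ?s + real j + teval l x)"
    using Cons clamp_add[of "teval l x" "r + ?s + real j"]
    by (auto simp: nth_shift_add add_ac)
  then show ?case by (simp add: add_ac)
qed (use assms(2) in auto)

lemma term_vars_foldr_shift_add:
  assumes "\<And>l. l \<in> set ls \<Longrightarrow> term_vars l \<subseteq> V" "\<And>t. t \<in> set L \<Longrightarrow> term_vars t \<subseteq> V"
  shows "t \<in> set (foldr shift_add ls L) \<Longrightarrow> term_vars t \<subseteq> V"
  using assms(1)
proof (induction ls arbitrary: t)
  case (Cons l ls)
  let ?L = "foldr shift_add ls L"
  have "t \<in> set (shift_add l ?L)" using Cons.prems(1) by simp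
  then obtain s u where "(s, u) \<in> set (zip ?L (tl ?L))"
    and t: "t = TNeg (TPlus (TNeg (TPlus s l)) (TNeg u))"
    by (auto simp: shift_add_def[of l])
  then have "s \<in> set ?L" "u \<in> set ?L"
    by (metis set_zip_leftD, metis list.sel(2) list.set_sel(2) set_zip_rightD)
  then show ?case using Cons t by auto
qed (use assms(2) in auto)

lemma literals_snoc:
  "literals (p @ [a]) = literals p @ replicate (nat a) (TVar (length p)) @
     replicate (nat (- a)) (TNeg (TVar (length p)))"
  by (simp add: literals_def zip_append)

lemma literals_vars: "l \<in> set (literals p) \<Longrightarrow> term_vars l \<subseteq> {..<length p}"
proof (induction p rule: rev_induct)
  case (snoc a p)
  then show ?case by (auto simp: literals_snoc less_Suc_eq subset_iff split: if_splits)
qed (simp add: literals_def)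

lemma neg_sum_append [simp]: "neg_sum (p @ q) = neg_sum p + neg_sum q"
  by (induction p) (auto simp: neg_sum_def)

lemma neg_sum_single [simp]: "neg_sum [a] = int (nat (- a))"
  by (simp add: neg_sum_def)

lemma sum_literals:
  "(\<Sum>l\<leftarrow>literals p. teval l x) - of_int (neg_sum p) = lin p (map x [0..<length p])"
proof (induction p rule: rev_induct)
  case (snoc a p)
  have "lin [a] [y] = real (nat a) * y + real (nat (- a)) * (1 - y) - real (nat (- a))" for y
    by (cases "0 \<le> a") (auto simp: algebra_simps)
  then show ?case
    using snoc by (simp add: literals_snoc lin_append sum_list_replicate)
qed (simp add: literals_def neg_sum_def)

lemma
  assumes "length p = Suc m"
  shows term_vars_clamp_term: "term_vars (clamp_term p) \<subseteq> {..<m}"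
    and teval_clamp_term: "(\<And>i. i < m \<Longrightarrow> 0 \<le> x i \<and> x i \<le> 1) \<Longrightarrow>
      teval (clamp_term p) x = clamp (lin p (1 # map x [0..<m]))"
proof -
  let ?ls = "literals (tl p)"
  let ?k = "hd p - neg_sum (tl p)"
  let ?L = "map (\<lambda>j. if 0 < ?k + int j then TNeg TZero else TZero) [0..<Suc (length ?ls)]"
  have hd: "clamp_term p = foldr shift_add ?ls ?L ! 0"
    unfolding clamp_term_def by (intro hd_conv_nth) (auto simp flip: length_greater_0_conv)
  have "foldr shift_add ?ls ?L ! 0 \<in> set (foldr shift_add ?ls ?L)"
    by (rule nth_mem) simp
  then show "term_vars (clamp_term p) \<subseteq> {..<m}"
    unfolding hd
  proof (rule term_vars_foldr_shift_add[rotated 2])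
    show "term_vars l \<subseteq> {..<m}" if "l \<in> set ?ls" for l
      using literals_vars[OF that] assms by simp
    show "term_vars t \<subseteq> {..<m}" if t: "t \<in> set ?L" for t
    proof -
      have "t = TNeg TZero \<or> t = TZero"
        using t unfolding set_map by (elim imageE) presburger
      then show ?thesis by auto
    qed
  qed
  assume x: "\<And>i. i < m \<Longrightarrow> 0 \<le> x i \<and> x i \<le> 1"
  have "0 \<le> teval l x \<and> teval l x \<le> 1" if "l \<in> set ?ls" for l
    using literals_vars[OF that] x assms by (intro conjI teval_bounds) auto
  moreover have "teval (?L ! j) x = clamp (of_int ?k + real j)" if "j < length ?L" for j
  proof -
    have L: "?L ! j = (if 0 < ?k + int j then TNeg TZero else TZero)"
      using that by (subst nth_map) (auto simp del: upt_Suc)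
    \<comment> \<open>Integrality enters here: an integer that is not positive clamps to 0, and a
      positive one is at least 1 and clamps to 1.\<close>
    have "real_of_int (?k + int j) \<le> 0" if "\<not> 0 < ?k + int j"
      using that by (simp only: of_int_le_0_iff not_less)
    moreover have "1 \<le> real_of_int (?k + int j)" if "0 < ?k + int j"
      using that by (simp only: of_int_1_le_iff int_one_le_iff_zero_less)
    ultimately show ?thesis
      unfolding L by (simp add: clamp_def)
  qed
  ultimately have "teval (foldr shift_add ?ls ?L ! 0) x =
      clamp (of_int ?k + (\<Sum>l\<leftarrow>?ls. teval l x) + real 0)"
    by (intro teval_foldr_shift_add) auto
  also have "of_int ?k + (\<Sum>l\<leftarrow>?ls. teval l x) + real 0 = lin p (1 # map x [0..<m])"
    using sum_literals[of x "tl p"] assms by (cases p) auto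
  finally show "teval (clamp_term p) x = clamp (lin p (1 # map x [0..<m]))"
    by (simp only: hd)
qed

text \<open>Zero sets turn \<open>tmin\<close> into union and \<open>TPlus\<close> into
  intersection, and \<open>clamp (- r)\<close> vanishes exactly for \<open>r \<ge> 0\<close>. The
  empty disjunction becomes the constant 1, which has no zeros.\<close>

definition dnf_term :: "int list list list \<Rightarrow> mvterm" where
  "dnf_term D = foldr (\<lambda>C. tmin (foldr (\<lambda>p. TPlus (clamp_term (map uminus p))) C TZero)) D (TNeg TZero)"

lemma
  assumes "forms_of_length (Suc m) D"
  shows term_vars_dnf_term: "term_vars (dnf_term D) \<subseteq> {..<m}"
    and teval_dnf_term: "(\<And>i. i < m \<Longrightarrow> 0 \<le> x i \<and> x i \<le> 1) \<Longrightarrow>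
      teval (dnf_term D) x = 0 \<longleftrightarrow> sat D (1 # map x [0..<m])"
proof -
  let ?c = "\<lambda>C. foldr (\<lambda>p. TPlus (clamp_term (map uminus p))) C TZero"
  have c_vars: "term_vars (?c C) \<subseteq> {..<m}" if "\<forall>p\<in>set C. length p = Suc m" for C
    using that term_vars_clamp_term[of "map uminus _" m] by (induction C) auto
  show vars: "term_vars (dnf_term D) \<subseteq> {..<m}"
    using assms c_vars unfolding forms_of_length_def dnf_term_def by (induction D) auto
  assume x: "\<And>i. i < m \<Longrightarrow> 0 \<le> x i \<and> x i \<le> 1"
  have c: "0 \<le> teval (?c C) x \<and> (teval (?c C) x = 0 \<longleftrightarrow> holds C (1 # map x [0..<m]))"
    if "\<forall>p\<in>set C. length p = Suc m" for C
    using that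
  proof (induction C)
    case (Cons p C)
    have "teval (clamp_term (map uminus p)) x = clamp (- lin p (1 # map x [0..<m]))"
      using Cons.prems x by (subst teval_clamp_term[of _ m]) auto
    then have "0 \<le> teval (clamp_term (map uminus p)) x"
      "teval (clamp_term (map uminus p)) x = 0 \<longleftrightarrow> 0 \<le> lin p (1 # map x [0..<m])"
      by (auto simp: clamp_def)
    with Cons show ?case by (auto simp: min_def)
  qed simp
  have "0 \<le> teval (dnf_term D) x \<and> (teval (dnf_term D) x = 0 \<longleftrightarrow> sat D (1 # map x [0..<m]))"
    using assms unfolding forms_of_length_def dnf_term_def
  proof (induction D)
    case (Cons C D)
    then have C: "0 \<le> teval (?c C) x \<and> (teval (?c C) x = 0 \<longleftrightarrow> holds C (1 # map x [0..<m]))"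
      by (intro c) auto
    with Cons show ?case by (auto simp: teval_tmin sat_def min_def)
  qed (simp add: sat_def)
  then show "teval (dnf_term D) x = 0 \<longleftrightarrow> sat D (1 # map x [0..<m])" by simp
qed


section \<open>The algorithm\<close>

text \<open>The redundant generator 0 makes the number of generators positive.\<close>

definition present :: "nat \<times> mvterm list \<Rightarrow> nat \<times> mvterm" where
  "present q = (length (TZero # snd q), dnf_term (range_dnf (fst q) (TZero # snd q)))"

lemma computable_lincomb:
  assumes "computable a" "computable p" "computable b" "computable q"
  shows "computable (\<lambda>x. lincomb (a x) (p x) (b x) (q x))"
  unfolding lincomb_def
  by (intro assms(2,4) computable_intros computable_compose[OF assms(1)]
      computable_compose[OF assms(3)])

lemma computable_unit_form:
  assumes "computable N" "computable i"
  shows "computable (\<lambda>x. unit_form (N x) (i x))"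
  unfolding unit_form_def by (intro assms(1) computable_intros computable_compose[OF assms(2)])

lemma computable_elim:
  assumes "computable f"
  shows "computable (\<lambda>x. elim (f x))"
proof (rule computable_compose[OF _ assms])
  show "computable elim"
    unfolding elim_def elim_conj_def by (intro computable_lincomb computable_intros)
qed

lemma computable_pieces:
  assumes "computable N" "computable k" "computable t"
  shows "computable (\<lambda>x. pieces (N x) (k x) (t x))"
proof -
  have "computable (\<lambda>x. (\<lambda>(N, k). pieces N k) (N x, k x) (t x))"
  proof (rule computable_mvterm_recursion[where a = "\<lambda>e i. [([], unit_form (fst e) i)]" and
        z = "\<lambda>e. [([], replicate (fst e) 0)]" and
        g = "\<lambda>e L. map (\<lambda>P. (fst P, lincomb 1 (unit_form (fst e) (snd e)) (- 1) (snd P))) L" and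
        h = "\<lambda>e L M. concat (map (\<lambda>P. concat (map (plus_pieces (unit_form (fst e) (snd e)) P) M)) L)"])
    show "computable (\<lambda>p. concat (map (\<lambda>P. concat (map (plus_pieces
        (unit_form (fst (fst p)) (snd (fst p))) P) (snd (snd p)))) (fst (snd p))))"
      unfolding plus_pieces_def Let_def
      by (intro computable_lincomb computable_unit_form computable_intros)
  qed (auto intro!: computable_lincomb computable_unit_form computable_intros assms)
  then show ?thesis by simp
qed

lemma computable_range_dnf:
  assumes "computable n" "computable ts"
  shows "computable (\<lambda>x. range_dnf (n x) (ts x))"
  unfolding range_dnf_def dnf_conj_def graph_dnf_def upper_bounds_def
  by (intro computable_elim computable_lincomb computable_unit_form computable_pieces
      computable_intros computable_compose[OF assms(1)] computable_compose[OF assms(2)] assms)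

lemma computable_clamp_term:
  assumes "computable f"
  shows "computable (\<lambda>x. clamp_term (f x))"
  unfolding clamp_term_def shift_add_def literals_def neg_sum_def
  by (intro computable_intros computable_compose[OF assms])

lemma computable_dnf_term:
  assumes "computable f"
  shows "computable (\<lambda>x. dnf_term (f x))"
  unfolding dnf_term_def tmin_def tmax_def
  by (intro computable_clamp_term computable_intros assms)

lemma computable_present: "computable present"
  unfolding present_def[abs_def]
  by (intro computable_dnf_term computable_range_dnf computable_intros)


section \<open>McNaughton functions are term functions\<close>

lemma cube_bounds: "x \<in> cube n \<Longrightarrow> i < n \<Longrightarrow> 0 \<le> x i \<and> x i \<le> 1"
  by (auto simp: cube_def PiE_iff)

lemma cube_teval_bounds:
  assumes "x \<in> cube n" "term_vars t \<subseteq> {..<n}"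
  shows "0 \<le> teval t x" "teval t x \<le> 1"
  using assms teval_bounds[of t x] cube_bounds by blast+

lemma mcnaughton_bounds: "f \<in> mcnaughton n \<Longrightarrow> x \<in> cube n \<Longrightarrow> 0 \<le> f x \<and> f x \<le> 1"
  by (auto simp: mcnaughton_def PiE_iff)

lemma int_affine_lin:
  assumes "int_affine n p"
  obtains q where "length q = Suc n" "\<And>x. p x = lin q (1 # map x [0..<n])"
proof -
  from assms obtain b a where "\<And>x. p x = of_int b + (\<Sum>i<n. of_int (a i) * x i)"
    by (auto simp: int_affine_def)
  then have "p x = lin (b # map a [0..<n]) (1 # map x [0..<n])" for x
    by (simp add: lin_conv_sum)
  then show thesis by (intro that[of "b # map a [0..<n]"]) auto
qed

section \<open>The max-min representation of McNaughton functions\<close>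

lemma affine_positive_between:
  fixes c0 c1 s t :: real
  assumes "0 \<le> s" "s < t" "0 < c0" "0 < (1 - t) * c0 + t * c1"
  shows "0 < (1 - s) * c0 + s * c1"
proof -
  have "t * ((1 - s) * c0 + s * c1) = (t - s) * c0 + s * ((1 - t) * c0 + t * c1)"
    by (simp add: algebra_simps)
  also have "\<dots> > 0"
    using assms by (intro add_pos_nonneg mult_pos_pos mult_nonneg_nonneg) auto
  finally show ?thesis using assms by (simp add: zero_less_mult_iff)
qed

text \<open>The last parameter \<open>t0\<close> on the segment at which some piece below \<open>f\<close> at \<open>a\<close> is above \<open>f\<close> must
  be 1: a piece active right after \<open>t0\<close> would start above such a piece, meet it by \<open>t0\<close> and exceed it
  again later.\<close>

lemma piece_through_two_points:
  assumes cont: "continuous_on (cube n) f"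
    and P: "finite P" "\<And>p. p \<in> P \<Longrightarrow> int_affine n p" "\<And>x. x \<in> cube n \<Longrightarrow> \<exists>p\<in>P. f x = p x"
    and ab: "a \<in> cube n" "b \<in> cube n"
  shows "\<exists>p\<in>P. p a \<le> f a \<and> f b \<le> p b"
proof -
  define \<gamma> where "\<gamma> = (\<lambda>t. \<lambda>i\<in>{..<n}. (1 - t) * a i + t * b i)"
  have \<gamma>01: "\<gamma> 0 = a" "\<gamma> 1 = b"
    using ab by (auto simp: \<gamma>_def cube_def PiE_iff extensional_def restrict_def)
  have \<gamma>_cube: "\<gamma> t \<in> cube n" if "t \<in> {0..1}" for t
    using that cube_bounds[OF ab(1)] cube_bounds[OF ab(2)]
    by (auto simp: \<gamma>_def cube_def intro!: add_nonneg_nonneg mult_nonneg_nonneg convex_bound_le)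
  have "continuous_on {0..1} \<gamma>"
    unfolding \<gamma>_def
  proof (rule continuous_on_coordinatewise_then_product)
    show "continuous_on {0..1} (\<lambda>t. (\<lambda>i\<in>{..<n}. (1 - t) * a i + t * b i) i)" for i
      by (cases "i < n") (auto intro!: continuous_intros)
  qed
  then have contg: "continuous_on {0..1} (\<lambda>t. f (\<gamma> t))"
    using \<gamma>_cube by (intro continuous_on_compose2[OF cont]) auto
  have p_\<gamma>: "p (\<gamma> t) = (1 - t) * p a + t * p b" if p: "p \<in> P" for p t
  proof -
    obtain c w where c: "\<And>x. p x = of_int c + (\<Sum>i<n. of_int (w i) * x i)"
      using P(2)[OF p] by (auto simp: int_affine_def)
    have "(\<Sum>i<n. of_int (w i) * \<gamma> t i) =
        (1 - t) * (\<Sum>i<n. of_int (w i) * a i) + t * (\<Sum>i<n. of_int (w i) * b i)"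
      by (simp add: \<gamma>_def sum_distrib_left flip: sum.distrib) (simp add: algebra_simps)
    then show ?thesis by (simp add: c algebra_simps)
  qed
  have contp: "continuous_on {0..1} (\<lambda>t. p (\<gamma> t))" if "p \<in> P" for p
    unfolding p_\<gamma>[OF that] by (intro continuous_intros)
  define I where "I = {p \<in> P. p a \<le> f a}"
  define T where "T = (\<Union>p\<in>I. {t \<in> {0..1}. f (\<gamma> t) \<le> p (\<gamma> t)})"
  have "closed T"
    unfolding T_def
    by (intro closed_UN ballI continuous_on_closed_Collect_le contg contp) (use P in \<open>auto simp: I_def\<close>)
  moreover have "T \<subseteq> {0..1}" by (auto simp: T_def)
  ultimately have "compact T"
    by (metis Int_absorb1 compact_Icc compact_Int_closed)
  moreover have "0 \<in> T"
    using P(3)[OF ab(1)] by (auto simp: T_def I_def \<gamma>01)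
  ultimately obtain t0 where t0: "t0 \<in> T" "\<And>t. t \<in> T \<Longrightarrow> t \<le> t0"
    using compact_attains_sup[of T] by blast
  then obtain p where p: "p \<in> I" "f (\<gamma> t0) \<le> p (\<gamma> t0)" and t001: "0 \<le> t0" "t0 \<le> 1"
    by (auto simp: T_def)
  show ?thesis
  proof (cases "t0 = 1")
    case True
    then show ?thesis using p by (auto simp: I_def \<gamma>01)
  next
    case False
    \<comment> \<open>\<open>U\<close> collects the parameters at which a piece not passing through
      the graph at \<open>t0\<close> is active. It is closed and misses \<open>t0\<close>, so every
      piece active shortly after \<open>t0\<close> agrees with \<open>f\<close> at
      \<open>t0\<close>.\<close>
    define U where "U = (\<Union>q\<in>{q \<in> P. q (\<gamma> t0) \<noteq> f (\<gamma> t0)}. {t \<in> {0..1}. f (\<gamma> t) = q (\<gamma> t)})"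
    have "closed U"
      unfolding U_def
    proof (intro closed_UN ballI)
      show "closed {t \<in> {0..1}. f (\<gamma> t) = q (\<gamma> t)}" if "q \<in> {q \<in> P. q (\<gamma> t0) \<noteq> f (\<gamma> t0)}" for q
      proof -
        have "{t \<in> {0..1}. f (\<gamma> t) = q (\<gamma> t)} =
            {t \<in> {0..1}. f (\<gamma> t) \<le> q (\<gamma> t)} \<inter> {t \<in> {0..1}. q (\<gamma> t) \<le> f (\<gamma> t)}"
          by auto
        moreover have "q \<in> P" using that by simp
        ultimately show ?thesis
          by (simp only:) (intro closed_Int continuous_on_closed_Collect_le contg contp closed_atLeastAtMost)
      qed
    qed (use P in auto)
    moreover have "t0 \<notin> U" by (auto simp: U_def)
    ultimately obtain e where e: "0 < e" "ball t0 e \<subseteq> - U"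
      by (metis ComplI open_Compl openE)
    define t where "t = min 1 (t0 + e / 2)"
    have t: "t0 < t" "t \<le> 1" "0 \<le> t" using e False t001 by (auto simp: t_def)
    have "t \<in> ball t0 e" using e t by (auto simp: t_def dist_real_def)
    then have "t \<notin> U" using e by auto
    obtain q where q: "q \<in> P" "f (\<gamma> t) = q (\<gamma> t)"
      using P(3)[OF \<gamma>_cube] t by force
    then have qt0: "q (\<gamma> t0) = f (\<gamma> t0)"
      using \<open>t \<notin> U\<close> t by (auto simp: U_def)
    have "t \<notin> T" using t0(2)[of t] t by auto
    then have "f a < q a" "p (\<gamma> t) < f (\<gamma> t)"
      using q p(1) t by (auto simp: T_def I_def not_le)
    then have "0 < q a - p a" "0 < (1 - t) * (q a - p a) + t * (q b - p b)"
      using p(1) q by (auto simp: I_def p_\<gamma> algebra_simps)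
    from affine_positive_between[OF t001(1) t(1) this]
    have "p (\<gamma> t0) < q (\<gamma> t0)"
      using p(1) q by (auto simp: I_def p_\<gamma> algebra_simps)
    then show ?thesis using p(2) qt0 by simp
  qed
qed

definition term_definable :: "nat \<Rightarrow> ((nat \<Rightarrow> real) \<Rightarrow> real) \<Rightarrow> bool" where
  "term_definable n g \<longleftrightarrow> (\<exists>t. term_vars t \<subseteq> {..<n} \<and> (\<forall>x\<in>cube n. g x = teval t x))"

lemma term_definable_min:
  assumes "term_definable n f" "term_definable n g"
  shows "term_definable n (\<lambda>x. min (f x) (g x))"
proof -
  obtain s t where "term_vars s \<subseteq> {..<n}" "\<forall>x\<in>cube n. f x = teval s x"
    "term_vars t \<subseteq> {..<n}" "\<forall>x\<in>cube n. g x = teval t x"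
    using assms by (auto simp: term_definable_def)
  then show ?thesis
    unfolding term_definable_def
    by (intro exI[of _ "tmin s t"]) (auto simp: teval_tmin cube_teval_bounds)
qed

lemma term_definable_max:
  assumes "term_definable n f" "term_definable n g"
  shows "term_definable n (\<lambda>x. max (f x) (g x))"
proof -
  obtain s t where "term_vars s \<subseteq> {..<n}" "\<forall>x\<in>cube n. f x = teval s x"
    "term_vars t \<subseteq> {..<n}" "\<forall>x\<in>cube n. g x = teval t x"
    using assms by (auto simp: term_definable_def)
  then show ?thesis
    unfolding term_definable_def
    by (intro exI[of _ "tmax s t"]) (auto simp: teval_tmax cube_teval_bounds)
qed

lemma term_definable_Min:
  assumes "finite A" "A \<noteq> {}" "\<And>a. a \<in> A \<Longrightarrow> term_definable n (g a)"
  shows "term_definable n (\<lambda>x. Min ((\<lambda>a. g a x) ` A))"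
  using assms by (induction A rule: finite_ne_induct) (auto intro: term_definable_min)

lemma term_definable_Max:
  assumes "finite A" "A \<noteq> {}" "\<And>a. a \<in> A \<Longrightarrow> term_definable n (g a)"
  shows "term_definable n (\<lambda>x. Max ((\<lambda>a. g a x) ` A))"
  using assms by (induction A rule: finite_ne_induct) (auto intro: term_definable_max)

lemma term_definable_clamp:
  assumes "int_affine n p"
  shows "term_definable n (\<lambda>x. clamp (p x))"
proof -
  obtain q where "length q = Suc n" "\<And>x. p x = lin q (1 # map x [0..<n])"
    using int_affine_lin[OF assms] by blast
  then show ?thesis
    unfolding term_definable_def
    by (intro exI[of _ "clamp_term q"]) (auto simp: term_vars_clamp_term teval_clamp_term cube_bounds)
qed

lemma cube_nonempty: "cube n \<noteq> {}"
  by (auto simp: cube_def PiE_eq_empty_iff)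

lemma clamp_mono: "r \<le> s \<Longrightarrow> clamp r \<le> clamp s"
  by (auto simp: clamp_def)

lemma clamp_id: "0 \<le> r \<Longrightarrow> r \<le> 1 \<Longrightarrow> clamp r = r"
  by (simp add: clamp_def)

text \<open>With \<open>S b\<close> the pieces that are above \<open>f\<close> at \<open>b\<close>, the function is the maximum over \<open>b\<close> of the
  minimum of \<open>S b\<close>.\<close>

theorem mcnaughton_term_definable:
  assumes f: "f \<in> mcnaughton n"
  shows "term_definable n f"
proof -
  obtain P where P: "finite P" "\<And>p. p \<in> P \<Longrightarrow> int_affine n p"
    "\<And>x. x \<in> cube n \<Longrightarrow> \<exists>p\<in>P. f x = p x" and cont: "continuous_on (cube n) f"
    using f by (auto simp: mcnaughton_def)
  define S where "S = (\<lambda>b. {p \<in> P. f b \<le> p b})"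
  \<comment> \<open>Affine pieces may leave \<open>[0,1]\<close> and then are no terms. Clamping
    repairs this and preserves comparisons with \<open>f\<close>, because it is monotone and fixes
    the values of \<open>f\<close>.\<close>
  define g where "g = (\<lambda>x. Max ((\<lambda>Q. Min ((\<lambda>p. clamp (p x)) ` Q)) ` (S ` cube n)))"
  have finS: "finite (S b)" for b using P by (simp add: S_def)
  have neS: "S b \<noteq> {}" if "b \<in> cube n" for b
    using P(3)[OF that] by (auto simp: S_def)
  have "S ` cube n \<subseteq> Pow P" by (auto simp: S_def)
  then have fin: "finite (S ` cube n)" using P(1) by (meson finite_Pow_iff finite_subset)
  have "term_definable n g"
    unfolding g_def
  proof (intro term_definable_Max term_definable_Min term_definable_clamp fin)
    show "S ` cube n \<noteq> {}" using cube_nonempty by simp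
  qed (use finS neS P(2) in \<open>auto simp: S_def\<close>)
  moreover have "f x = g x" if x: "x \<in> cube n" for x
  proof (rule antisym)
    have fx: "clamp (f x) = f x" using mcnaughton_bounds[OF f x] by (simp add: clamp_id)
    have "f x \<le> Min ((\<lambda>p. clamp (p x)) ` S x)"
      using finS neS[OF x] clamp_mono[of "f x"] fx by (auto simp: S_def)
    then show "f x \<le> g x"
      unfolding g_def using fin x cube_nonempty by (subst Max_ge_iff) auto
    have "Min ((\<lambda>p. clamp (p x)) ` S b) \<le> f x" if b: "b \<in> cube n" for b
    proof -
      obtain p where "p \<in> S b" "p x \<le> f x"
        using piece_through_two_points[OF cont P x b] by (auto simp: S_def)
      then show ?thesis
        using finS neS[OF b] clamp_mono[of "p x" "f x"] fx by (subst Min_le_iff) auto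
    qed
    then show "g x \<le> f x"
      unfolding g_def using fin cube_nonempty by (subst Max_le_iff) auto
  qed
  ultimately show ?thesis by (simp add: term_definable_def)
qed

section \<open>Term functions are McNaughton functions\<close>

lemma int_affine_const: "int_affine n (\<lambda>x. of_int c)"
  unfolding int_affine_def by (intro exI[of _ c] exI[of _ "\<lambda>_. 0"]) simp

lemma int_affine_coordinate:
  assumes "i < n"
  shows "int_affine n (\<lambda>x. x i)"
proof -
  have "x i = of_int 0 + (\<Sum>j<n. of_int (if j = i then 1 else 0) * x j)" for x :: "nat \<Rightarrow> real"
  proof -
    have "(\<Sum>j<n. of_int (if j = i then 1 else 0) * x j) = (\<Sum>j<n. if j = i then x i else 0)"
      by (intro sum.cong) auto
    then show ?thesis using assms by simp
  qed
  then show ?thesis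
    unfolding int_affine_def by (intro exI[of _ 0] exI[of _ "\<lambda>j. if j = i then 1 else 0"] allI)
qed

lemma int_affine_add:
  assumes "int_affine n p" "int_affine n q"
  shows "int_affine n (\<lambda>x. p x + q x)"
proof -
  obtain a b c d where "\<And>x. p x = of_int b + (\<Sum>i<n. of_int (a i) * x i)"
    "\<And>x. q x = of_int d + (\<Sum>i<n. of_int (c i) * x i)"
    using assms unfolding int_affine_def by blast
  then have "p x + q x = of_int (b + d) + (\<Sum>i<n. of_int (a i + c i) * x i)" for x
    by (simp add: sum.distrib algebra_simps)
  then show ?thesis unfolding int_affine_def by (intro exI allI)
qed

lemma int_affine_one_minus:
  assumes "int_affine n p"
  shows "int_affine n (\<lambda>x. 1 - p x)"
proof -
  obtain a b where "\<And>x. p x = of_int b + (\<Sum>i<n. of_int (a i) * x i)"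
    using assms unfolding int_affine_def by blast
  then have "1 - p x = of_int (1 - b) + (\<Sum>i<n. of_int (- a i) * x i)" for x
    by (simp add: sum_negf)
  then show ?thesis unfolding int_affine_def by (intro exI allI)
qed

lemma teval_piecewise_affine:
  assumes "term_vars t \<subseteq> {..<n}"
  shows "\<exists>P. finite P \<and> (\<forall>p\<in>P. int_affine n p) \<and> (\<forall>x. \<exists>p\<in>P. teval t x = p x)"
  using assms
proof (induction t)
  case (TVar i)
  then show ?case by (intro exI[of _ "{\<lambda>x. x i}"]) (auto simp: int_affine_coordinate)
next
  case TZero
  show ?case
    using int_affine_const[of n 0] by (intro exI[of _ "{\<lambda>x. 0}"]) auto
next
  case (TNeg s)
  then obtain P where "finite P" "\<forall>p\<in>P. int_affine n p" "\<forall>x. \<exists>p\<in>P. teval s x = p x"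
    by auto
  then show ?case
    by (intro exI[of _ "(\<lambda>p x. 1 - p x) ` P"]) (auto simp: int_affine_one_minus)
next
  case (TPlus s t)
  then obtain P Q where P: "finite P" "\<forall>p\<in>P. int_affine n p" "\<forall>x. \<exists>p\<in>P. teval s x = p x"
    and Q: "finite Q" "\<forall>p\<in>Q. int_affine n p" "\<forall>x. \<exists>p\<in>Q. teval t x = p x"
    by auto
  have "\<exists>p\<in>insert (\<lambda>x. 1) ((\<lambda>(p, q) x. p x + q x) ` (P \<times> Q)). teval (TPlus s t) x = p x" for x
    using P(3) Q(3) by (auto simp: min_def) metis
  then show ?case
    using P Q int_affine_const[of n 1]
    by (intro exI[of _ "insert (\<lambda>x. 1) ((\<lambda>(p, q) x. p x + q x) ` (P \<times> Q))"])
      (auto simp: int_affine_add)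
qed

lemma continuous_on_teval: "continuous_on S (teval t)"
proof (induction t)
  case (TVar i)
  show ?case
    using continuous_on_subset[OF continuous_on_product_coordinates, of S i] by simp
qed (auto intro!: continuous_intros continuous_on_min)

lemma restrict_teval_mcnaughton:
  assumes "term_vars t \<subseteq> {..<n}"
  shows "restrict (teval t) (cube n) \<in> mcnaughton n"
proof -
  have "continuous_on (cube n) (restrict (teval t) (cube n))"
    using continuous_on_teval by (simp cong: continuous_on_cong)
  then show ?thesis
    using teval_piecewise_affine[OF assms] cube_teval_bounds[OF _ assms]
    unfolding mcnaughton_def by auto
qed

text \<open>Allows every later argument about the free algebra to work with terms, by induction or
  by elimination, in place of continuous piecewise affine functions.\<close>

lemma mcnaughton_eq: "mcnaughton n = (\<lambda>t. restrict (teval t) (cube n)) ` {t. term_vars t \<subseteq> {..<n}}"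
proof (intro equalityI subsetI)
  fix f assume f: "f \<in> mcnaughton n"
  then obtain t where t: "term_vars t \<subseteq> {..<n}" "\<forall>x\<in>cube n. f x = teval t x"
    using mcnaughton_term_definable unfolding term_definable_def by blast
  moreover have "f = restrict (teval t) (cube n)"
    using f t by (intro extensionalityI[of _ "cube n"]) (auto simp: mcnaughton_def PiE_iff)
  ultimately show "f \<in> (\<lambda>t. restrict (teval t) (cube n)) ` {t. term_vars t \<subseteq> {..<n}}" by auto
qed (auto simp: restrict_teval_mcnaughton)


section \<open>Domination by a multiple\<close>

text \<open>The coordinates are the scaled point, the scale at index \<open>n\<close>, the scaled
  value of \<open>t\<close> at \<open>n + 1\<close> and that of \<open>s\<close> at
  \<open>n + 2\<close>. The last is later set to 1, which makes the one before it the ratio;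
  eliminating \<open>Suc n\<close> coordinates removes point and scale together.\<close>

definition ratio_dnf :: "nat \<Rightarrow> mvterm \<Rightarrow> mvterm \<Rightarrow> int list list list" where
  "ratio_dnf n s t = dnf_conj [upper_bounds (n + 3) n]
     (dnf_conj (graph_dnf (n + 3) n (n + 2) s) (graph_dnf (n + 3) n (n + 1) t))"

text \<open>By homogeneity, the ratios \<open>t/s\<close> are the values \<open>t(\<lambda>x, \<lambda>)\<close> subject to \<open>s(\<lambda>x, \<lambda>) = 1\<close>. They
  form a projection of a polyhedron, hence a closed set, which omits 0 if \<open>s\<close> vanishes wherever
  \<open>t\<close> does.\<close>

lemma zero_set_domination:
  assumes vars: "term_vars s \<subseteq> {..<n}" "term_vars t \<subseteq> {..<n}"
    and zero: "\<And>x. x \<in> cube n \<Longrightarrow> teval t x = 0 \<Longrightarrow> teval s x = 0"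
  obtains K :: nat where "\<And>x. x \<in> cube n \<Longrightarrow> teval s x \<le> K * teval t x"
proof -
  define E where "E = (elim ^^ Suc n) (ratio_dnf n s t)"
  define W where "W = {r. sat E [r, 1]}"
  have fol: "forms_of_length (Suc n + 2) (ratio_dnf n s t)"
    unfolding ratio_dnf_def
    by (auto intro!: forms_of_length_dnf_conj forms_of_length_graph_dnf
        forms_of_length_upper_bounds simp: numeral_3_eq_3)
  have sat_ratio: "sat (ratio_dnf n s t) (xs @ [r, 1]) \<longleftrightarrow>
      (\<forall>i<n. xs ! i \<le> xs ! n) \<and> 1 = xs ! n * teval s x \<and> r = xs ! n * teval t x"
    if "length xs = Suc n" "0 \<le> xs ! n" "\<And>i. i < n \<Longrightarrow> xs ! i = xs ! n * x i" for xs r x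
  proof -
    have graph: "sat (graph_dnf (n + 3) n j u) (xs @ [r, 1]) \<longleftrightarrow>
        (xs @ [r, 1]) ! j = (xs @ [r, 1]) ! n * teval u x"
      if "j < n + 3" "term_vars u \<subseteq> {..<n}" for j u
    proof (rule sat_graph_dnf)
      fix i assume "i \<in> term_vars u"
      then have "i < n" using that(2) by auto
      then show "i < n + 3 \<and> (xs @ [r, 1]) ! i = (xs @ [r, 1]) ! n * x i"
        using \<open>length xs = Suc n\<close> \<open>\<And>i. i < n \<Longrightarrow> xs ! i = xs ! n * x i\<close>[of i]
        by (simp add: nth_append)
    qed (use \<open>length xs = Suc n\<close> \<open>0 \<le> xs ! n\<close> \<open>j < n + 3\<close> in \<open>simp_all add: nth_append\<close>)
    have "sat (graph_dnf (n + 3) n (n + 2) s) (xs @ [r, 1]) \<longleftrightarrow> 1 = xs ! n * teval s x"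
      using graph[of "n + 2" s] that(1) vars by (simp add: nth_append)
    moreover have "sat (graph_dnf (n + 3) n (n + 1) t) (xs @ [r, 1]) \<longleftrightarrow> r = xs ! n * teval t x"
      using graph[of "n + 1" t] that(1) vars by (simp add: nth_append)
    moreover have "sat [upper_bounds (n + 3) n] (xs @ [r, 1]) \<longleftrightarrow> (\<forall>i<n. xs ! i \<le> xs ! n)"
      using that(1) by (auto simp: sat_def holds_upper_bounds nth_append)
    ultimately show ?thesis
      by (simp add: ratio_dnf_def sat_dnf_conj)
  qed
  have W_iff: "r \<in> W \<longleftrightarrow> (\<exists>xs. length xs = Suc n \<and> (\<forall>x\<in>set xs. 0 \<le> x) \<and>
      sat (ratio_dnf n s t) (xs @ [r, 1]))" for r
    unfolding W_def E_def using sat_elim_funpow[of "Suc n" "[r, 1]"] fol by simp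
  have "closed {r. 0 \<le> lin p [r, 1]}" for p
  proof -
    have "continuous_on UNIV (\<lambda>r. lin p [r, 1])"
    proof (cases p)
      case (Cons a q)
      then show ?thesis by (auto intro!: continuous_intros)
    qed simp
    then show ?thesis
      using continuous_on_closed_Collect_le[of UNIV "\<lambda>_. 0"] by (simp add: continuous_on_const)
  qed
  moreover have "W = (\<Union>C\<in>set E. \<Inter>p\<in>set C. {r. 0 \<le> lin p [r, 1]})"
    by (auto simp: W_def sat_def holds_def)
  ultimately have "closed W" by (auto intro!: closed_UN closed_INT)
  moreover have "0 \<notin> W"
  proof
    assume "0 \<in> W"
    then obtain xs where xs: "length xs = Suc n" "\<And>i. i < Suc n \<Longrightarrow> 0 \<le> xs ! i"
      and sat: "sat (ratio_dnf n s t) (xs @ [0, 1])"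
      by (auto simp: W_iff)
    \<comment> \<open>If the scale is 0, the bounds force all scaled coordinates to be 0, so the
      default point 0 still satisfies the scaling relation. That case is then refuted by the
      equation \<open>1 = xs ! n * teval s x\<close>.\<close>
    define x where "x = (\<lambda>i\<in>{..<n}. if xs ! n = 0 then 0 else xs ! i / xs ! n)"
    have le: "xs ! i \<le> xs ! n" if "i < n" for i
    proof -
      have "sat [upper_bounds (n + 3) n] (xs @ [0, 1])"
        using sat by (simp add: ratio_dnf_def sat_dnf_conj)
      then show ?thesis using that xs by (simp add: sat_def holds_upper_bounds nth_append)
    qed
    have "xs ! i = xs ! n * x i" if "i < n" for i
      using that le[of i] xs(2)[of i] by (auto simp: x_def)
    then have st: "1 = xs ! n * teval s x" "0 = xs ! n * teval t x"
      using sat_ratio[of xs x 0] sat xs by auto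
    have "x \<in> cube n"
      using le xs by (auto simp: x_def cube_def divide_le_eq_1 less_le)
    moreover have "teval t x = 0" using st by auto
    ultimately have "teval s x = 0" by (rule zero)
    then show False using st by simp
  qed
  ultimately obtain e where e: "0 < e" "ball 0 e \<subseteq> - W"
    by (metis ComplI open_Compl openE)
  \<comment> \<open>Ratios are nonnegative and avoid the ball of radius \<open>e\<close> around 0,
    so each is at least \<open>e\<close>, and any factor of at least \<open>1 / e\<close>
    dominates.\<close>
  obtain K :: nat where K: "1 / e \<le> K" using real_arch_simple by blast
  have "teval s x \<le> K * teval t x" if x: "x \<in> cube n" for x
  proof (cases "teval s x = 0")
    case True
    then show ?thesis using cube_teval_bounds(1)[OF x vars(2)] by simp
  next
    case False
    define l where "l = 1 / teval s x"
    have s: "0 < teval s x" using False cube_teval_bounds(1)[OF x vars(1)] by simp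
    then have l: "0 < l" by (simp add: l_def)
    let ?xs = "map (\<lambda>i. l * x i) [0..<n] @ [l]"
    have "sat (ratio_dnf n s t) (?xs @ [l * teval t x, 1])"
      using l s cube_bounds[OF x]
      by (subst sat_ratio[of _ x]) (auto simp: nth_append l_def divide_right_mono)
    then have "l * teval t x \<in> W"
      unfolding W_iff using l cube_bounds[OF x] by (intro exI[of _ ?xs]) auto
    then have "l * teval t x \<notin> ball 0 e" using e by auto
    moreover have "0 \<le> l * teval t x" using l cube_teval_bounds(1)[OF x vars(2)] by simp
    ultimately have "e \<le> l * teval t x" by (simp add: dist_real_def)
    then have "teval s x \<le> 1 / e * teval t x"
      using s e by (simp add: l_def field_simps)
    also have "\<dots> \<le> K * teval t x"
      using K cube_teval_bounds(1)[OF x vars(2)] by (intro mult_right_mono)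
    finally show ?thesis .
  qed
  then show thesis by (rule that)
qed


section \<open>Principal ideals and quotients\<close>

lemma mcn_simps [simp]:
  "carrier (mcn n) = mcnaughton n"
  "mv_plus (mcn n) f g = (\<lambda>x\<in>cube n. min 1 (f x + g x))"
  "mv_neg (mcn n) f = (\<lambda>x\<in>cube n. 1 - f x)"
  "mv_zero (mcn n) = (\<lambda>x\<in>cube n. 0)"
  by (simp_all add: mcn_def)

lemma term_fun_eq: "term_fun n t = restrict (teval t) (cube n)"
  unfolding term_fun_def by (induction t) (auto simp: restrict_def fun_eq_iff)

lemma mv_subalgebra_mcn: "mv_subalgebra (mcn n) (mcnaughton n)"
proof -
  have "(\<lambda>x\<in>cube n. 0) \<in> mcnaughton n"
    using restrict_teval_mcnaughton[of TZero n] by (simp add: restrict_def cong: if_cong)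
  moreover have "(\<lambda>x\<in>cube n. 1 - f x) \<in> mcnaughton n" if f: "f \<in> mcnaughton n" for f
  proof -
    obtain s where "term_vars s \<subseteq> {..<n}" "f = restrict (teval s) (cube n)"
      using f by (auto simp: mcnaughton_eq)
    then show ?thesis
      using restrict_teval_mcnaughton[of "TNeg s" n] by (simp add: restrict_def cong: if_cong)
  qed
  moreover have "(\<lambda>x\<in>cube n. min 1 (f x + g x)) \<in> mcnaughton n"
    if fg: "f \<in> mcnaughton n" "g \<in> mcnaughton n" for f g
  proof -
    obtain s t where "term_vars s \<subseteq> {..<n}" "f = restrict (teval s) (cube n)"
      "term_vars t \<subseteq> {..<n}" "g = restrict (teval t) (cube n)"
      using fg by (auto simp: mcnaughton_eq)
    then show ?thesis
      using restrict_teval_mcnaughton[of "TPlus s t" n] by (simp add: restrict_def cong: if_cong)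
  qed
  ultimately show ?thesis by (simp add: mv_subalgebra_def)
qed

lemma mv_le_mcn: "mv_le (mcn n) f g \<longleftrightarrow> (\<forall>x\<in>cube n. f x \<le> g x)"
  by (force simp: mv_le_def mv_one_def fun_eq_iff restrict_def min_def)

lemma mv_dist_mcn:
  "mv_dist (mcn n) f g = (\<lambda>x\<in>cube n. min 1 (max 0 (f x - g x) + max 0 (g x - f x)))"
  by (auto simp: mv_dist_def mv_diff_def fun_eq_iff restrict_def min_def max_def)

lemma mv_dist_mcn_closed:
  assumes "f \<in> mcnaughton n" "g \<in> mcnaughton n"
  shows "mv_dist (mcn n) f g \<in> mcnaughton n"
  using mv_subalgebra_mcn[of n] assms
  unfolding mv_subalgebra_def mv_dist_def mv_diff_def by blast

text \<open>An ideal containing \<open>g\<close> contains all its truncated multiples, being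
  iterated sums, and by \<open>zero_set_domination\<close> each function vanishing with
  \<open>g\<close> lies below one of them. Conversely, vanishing on a fixed set defines an
  ideal.\<close>

lemma mv_principal_ideal_mcn:
  assumes g: "g \<in> mcnaughton n"
  shows "mv_principal_ideal (mcn n) g = {f \<in> mcnaughton n. \<forall>x\<in>cube n. g x = 0 \<longrightarrow> f x = 0}"
    (is "_ = ?J")
proof
  have "mv_ideal (mcn n) ?J"
    unfolding mv_ideal_def
  proof (intro conjI ballI impI)
    show "mv_zero (mcn n) \<in> ?J"
      using mv_subalgebra_mcn[of n] by (simp add: mv_subalgebra_def)
    show "mv_plus (mcn n) f h \<in> ?J" if "f \<in> ?J" "h \<in> ?J" for f h
      using mv_subalgebra_mcn[of n] that by (simp add: mv_subalgebra_def)
    show "h \<in> ?J" if "f \<in> ?J" "h \<in> carrier (mcn n)" "mv_le (mcn n) h f" for f h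
      using that mcnaughton_bounds[of h n] by (force simp: mv_le_mcn)
  qed auto
  then show "mv_principal_ideal (mcn n) g \<subseteq> ?J"
    unfolding mv_principal_ideal_def by (intro hull_minimal) (use g in auto)
next
  show "?J \<subseteq> mv_principal_ideal (mcn n) g"
  proof
    fix f assume f: "f \<in> ?J"
    obtain s t where s: "term_vars s \<subseteq> {..<n}" "f = restrict (teval s) (cube n)"
      and t: "term_vars t \<subseteq> {..<n}" "g = restrict (teval t) (cube n)"
      using f g by (auto simp: mcnaughton_eq)
    obtain K :: nat where "\<And>x. x \<in> cube n \<Longrightarrow> teval s x \<le> K * teval t x"
      using zero_set_domination[OF s(1) t(1)] f s t by auto
    then have K: "f x \<le> K * g x" if "x \<in> cube n" for x
      using that s t by simp
    have "f \<in> J" if J: "mv_ideal (mcn n) J" "g \<in> J" for J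
    proof -
      have mult: "(\<lambda>x\<in>cube n. min 1 (real k * g x)) \<in> J" for k
      proof (induction k)
        case 0
        have "mv_zero (mcn n) \<in> J" using J by (simp add: mv_ideal_def)
        then show ?case by (simp add: restrict_def cong: if_cong)
      next
        case (Suc k)
        have "(\<lambda>x\<in>cube n. min 1 (real (Suc k) * g x)) =
            mv_plus (mcn n) (\<lambda>x\<in>cube n. min 1 (real k * g x)) g"
          using mcnaughton_bounds[OF g]
          by (auto simp: fun_eq_iff min_def algebra_simps)
            (smt (verit) mult_nonneg_nonneg of_nat_0_le_iff)+
        moreover have "mv_plus (mcn n) (\<lambda>x\<in>cube n. min 1 (real k * g x)) g \<in> J"
          using J Suc unfolding mv_ideal_def by blast
        ultimately show ?case by (simp only:)
      qed
      have "mv_le (mcn n) f (\<lambda>x\<in>cube n. min 1 (real K * g x))"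
        using K f mcnaughton_bounds[of f n] by (auto simp: mv_le_mcn)
      then show ?thesis
        using J(1) mult[of K] f unfolding mv_ideal_def by auto
    qed
    then show "f \<in> mv_principal_ideal (mcn n) g"
      by (auto simp: mv_principal_ideal_def hull_def)
  qed
qed

text \<open>The truncated distance of two functions is 0 exactly at the points where they
  agree.\<close>

lemma mv_cong_principal_ideal:
  assumes "g \<in> mcnaughton n"
  shows "mv_cong (mcn n) (mv_principal_ideal (mcn n) g) =
    {(f, h). f \<in> mcnaughton n \<and> h \<in> mcnaughton n \<and> (\<forall>x\<in>cube n. g x = 0 \<longrightarrow> f x = h x)}"
proof -
  have "min 1 (max 0 (a - b) + max 0 (b - a)) = 0 \<longleftrightarrow> a = b" for a b :: real
    by (auto simp: min_def max_def)
  then have "mv_dist (mcn n) f h \<in> mv_principal_ideal (mcn n) g \<longleftrightarrow>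
      (\<forall>x\<in>cube n. g x = 0 \<longrightarrow> f x = h x)" if "f \<in> mcnaughton n" "h \<in> mcnaughton n" for f h
    using mv_dist_mcn_closed[OF that] unfolding mv_principal_ideal_mcn[OF assms]
    by (simp add: mv_dist_mcn)
  then show ?thesis by (auto simp: mv_cong_def)
qed

text \<open>The first isomorphism theorem, with the isomorphism directed from \<open>B\<close> to
  the quotient: an element goes to its fibre under \<open>\<phi>\<close>. The classes are exactly
  these fibres, so the unions defining the operations run over equal sets; surjectivity makes the
  fibres nonempty, without which the unions would be empty.\<close>

lemma mv_isomorphic_quotient:
  assumes sub: "mv_subalgebra A (carrier A)"
    and hom: "\<phi> \<in> mv_hom A B" and surj: "\<phi> ` carrier A = carrier B"
    and cong: "mv_cong A J = {(x, y). x \<in> carrier A \<and> y \<in> carrier A \<and> \<phi> x = \<phi> y}"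
  shows "mv_isomorphic B (mv_quotient A J)"
proof -
  define h where "h = (\<lambda>b. {x \<in> carrier A. \<phi> x = b})"
  have class_eq: "mv_cong A J `` {x} = h (\<phi> x)" if "x \<in> carrier A" for x
    using that by (auto simp: cong h_def)
  have closed: "mv_zero A \<in> carrier A" "\<And>x. x \<in> carrier A \<Longrightarrow> mv_neg A x \<in> carrier A"
    "\<And>x y. x \<in> carrier A \<Longrightarrow> y \<in> carrier A \<Longrightarrow> mv_plus A x y \<in> carrier A"
    using sub by (auto simp: mv_subalgebra_def)
  have \<phi>: "\<phi> (mv_zero A) = mv_zero B" "\<And>x. x \<in> carrier A \<Longrightarrow> \<phi> (mv_neg A x) = mv_neg B (\<phi> x)"
    "\<And>x y. x \<in> carrier A \<Longrightarrow> y \<in> carrier A \<Longrightarrow> \<phi> (mv_plus A x y) = mv_plus B (\<phi> x) (\<phi> y)"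
    using hom by (auto simp: mv_hom_def)
  have nonempty: "\<exists>x. x \<in> h b" if "b \<in> carrier B" for b
  proof -
    have "b \<in> \<phi> ` carrier A" using that surj by (simp only:)
    then show ?thesis by (auto simp: h_def)
  qed
  have carrier: "carrier (mv_quotient A J) = h ` carrier B"
    unfolding mv_quotient_def quotient_def surj[symmetric] by (auto simp: class_eq image_iff)
  have "h \<in> mv_hom B (mv_quotient A J)"
    unfolding mv_hom_def
  proof (intro CollectI conjI ballI)
    show "h \<in> carrier B \<rightarrow> carrier (mv_quotient A J)" by (auto simp: carrier)
    show "h (mv_zero B) = mv_zero (mv_quotient A J)"
      using class_eq[OF closed(1)] \<phi>(1) by (simp add: mv_quotient_def)
    show "h (mv_neg B b) = mv_neg (mv_quotient A J) (h b)" if b: "b \<in> carrier B" for b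
    proof -
      have "mv_cong A J `` {mv_neg A x} = h (mv_neg B b)" if "x \<in> h b" for x
        using that by (auto simp: class_eq closed \<phi> h_def)
      then show ?thesis
        using nonempty[OF b] by (auto simp: mv_quotient_def)
    qed
    show "h (mv_plus B b c) = mv_plus (mv_quotient A J) (h b) (h c)"
      if bc: "b \<in> carrier B" "c \<in> carrier B" for b c
    proof -
      have "mv_cong A J `` {mv_plus A x y} = h (mv_plus B b c)" if "x \<in> h b" "y \<in> h c" for x y
        using that by (auto simp: class_eq closed \<phi> h_def)
      then show ?thesis
        using nonempty[OF bc(1)] nonempty[OF bc(2)] by (auto simp: mv_quotient_def)
    qed
  qed
  moreover have "inj_on h (carrier B)"
    using nonempty by (intro inj_onI) (force simp: h_def)
  ultimately show ?thesis
    unfolding mv_isomorphic_def using carrier by (auto simp: bij_betw_def)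
qed


section \<open>Presentation of the generated subalgebra\<close>

definition term_map :: "nat \<Rightarrow> mvterm list \<Rightarrow> (nat \<Rightarrow> real) \<Rightarrow> nat \<Rightarrow> real" where
  "term_map n ts = (\<lambda>x. \<lambda>j\<in>{..<length ts}. teval (ts ! j) x)"

definition pullback :: "nat \<Rightarrow> mvterm list \<Rightarrow> ((nat \<Rightarrow> real) \<Rightarrow> real) \<Rightarrow> (nat \<Rightarrow> real) \<Rightarrow> real" where
  "pullback n ts f = (\<lambda>x\<in>cube n. f (term_map n ts x))"

lemma term_map_cube:
  assumes "\<And>t. t \<in> set ts \<Longrightarrow> term_vars t \<subseteq> {..<n}" "x \<in> cube n"
  shows "term_map n ts x \<in> cube (length ts)"
  using cube_teval_bounds[OF assms(2) assms(1)] by (auto simp: term_map_def cube_def)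

text \<open>A term representing \<open>f\<close> shows how the pullback is built from the
  generators, so it lies in every subalgebra that contains them. This uses that McNaughton functions
  are term functions.\<close>

lemma pullback_in_subalgebra:
  assumes vars: "\<And>t. t \<in> set ts \<Longrightarrow> term_vars t \<subseteq> {..<n}"
    and S: "mv_subalgebra (mcn n) S" "term_fun n ` set ts \<subseteq> S"
    and f: "f \<in> mcnaughton (length ts)"
  shows "pullback n ts f \<in> S"
proof -
  obtain s where s: "term_vars s \<subseteq> {..<length ts}" "f = restrict (teval s) (cube (length ts))"
    using f by (auto simp: mcnaughton_eq)
  have "(\<lambda>x\<in>cube n. teval s (term_map n ts x)) \<in> S"
    using s(1)
  proof (induction s)
    case (TVar i)
    then have "(\<lambda>x\<in>cube n. teval (TVar i) (term_map n ts x)) = term_fun n (ts ! i)"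
      by (auto simp: term_map_def term_fun_eq)
    then show ?case using TVar S(2) by auto
  next
    case TZero
    have "mv_zero (mcn n) \<in> S" using S(1) unfolding mv_subalgebra_def by simp
    then show ?case by (simp add: restrict_def cong: if_cong)
  next
    case (TNeg s)
    then have "mv_neg (mcn n) (\<lambda>x\<in>cube n. teval s (term_map n ts x)) \<in> S"
      using S(1) unfolding mv_subalgebra_def by simp
    then show ?case by (simp add: restrict_def cong: if_cong)
  next
    case (TPlus s t)
    then have "mv_plus (mcn n) (\<lambda>x\<in>cube n. teval s (term_map n ts x))
        (\<lambda>x\<in>cube n. teval t (term_map n ts x)) \<in> S"
      using S(1) unfolding mv_subalgebra_def by simp
    then show ?case by (simp add: restrict_def cong: if_cong)
  qed
  moreover have "pullback n ts f = (\<lambda>x\<in>cube n. teval s (term_map n ts x))"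
    using term_map_cube[OF vars] by (auto simp: pullback_def s(2) fun_eq_iff)
  ultimately show ?thesis by simp
qed

lemma present_correct:
  assumes vars: "\<And>t. t \<in> set ts \<Longrightarrow> term_vars t \<subseteq> {..<n}" and \<sigma>: "present (n, ts) = (m, \<sigma>)"
  shows "0 < m" "term_vars \<sigma> \<subseteq> {..<m}"
    "mv_isomorphic (mv_generated (mcn n) (term_fun n ` set ts))
      (mv_quotient (mcn m) (mv_principal_ideal (mcn m) (term_fun m \<sigma>)))"
proof -
  define us where "us = TZero # ts"
  define T where "T = term_map n us"
  define \<phi> where "\<phi> = pullback n us"
  have m: "m = length us" and \<sigma>_eq: "\<sigma> = dnf_term (range_dnf n us)"
    using \<sigma> by (auto simp: present_def us_def)
  show "0 < m" by (simp add: m us_def)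
  have us: "term_vars t \<subseteq> {..<n}" if "t \<in> set us" for t
    using that vars by (auto simp: us_def)
  have T_cube: "T x \<in> cube m" if "x \<in> cube n" for x
    unfolding T_def m using term_map_cube[OF us that] by simp
  have fol: "forms_of_length (Suc m) (range_dnf n us)"
    unfolding m by (rule forms_of_length_range_dnf)
  show \<sigma>_vars: "term_vars \<sigma> \<subseteq> {..<m}"
    unfolding \<sigma>_eq by (rule term_vars_dnf_term[OF fol])
  have zero_set: "teval \<sigma> y = 0 \<longleftrightarrow> y \<in> T ` cube n" if y: "y \<in> cube m" for y
  proof -
    have "teval \<sigma> y = 0 \<longleftrightarrow> sat (range_dnf n us) (1 # map y [0..<m])"
      unfolding \<sigma>_eq using cube_bounds[OF y] by (intro teval_dnf_term fol)
    also have "\<dots> \<longleftrightarrow> (\<exists>x. (\<forall>i<n. 0 \<le> x i \<and> x i \<le> 1) \<and>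
        (\<forall>j<length us. map y [0..<m] ! j = teval (us ! j) x))"
      using us by (intro sat_range_dnf) (auto simp: m)
    also have "\<dots> \<longleftrightarrow> y \<in> T ` cube n"
    proof safe
      fix x assume x: "\<forall>i<n. 0 \<le> x i \<and> x i \<le> 1"
        "\<forall>j<length us. map y [0..<m] ! j = teval (us ! j) x"
      have "restrict x {..<n} \<in> cube n" using x by (auto simp: cube_def)
      moreover have "y = T (restrict x {..<n})"
      proof
        fix j
        show "y j = T (restrict x {..<n}) j"
        proof (cases "j < m")
          case True
          then have "teval (us ! j) (restrict x {..<n}) = teval (us ! j) x"
            using us[of "us ! j"] by (intro teval_cong) (auto simp: m subset_iff)
          then show ?thesis using x(2) True by (simp add: T_def term_map_def m)
        next
          case False
          then show ?thesis
            using y by (auto simp: T_def term_map_def m cube_def PiE_iff extensional_def)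
        qed
      qed
      ultimately show "y \<in> T ` cube n" by blast
    next
      fix x assume "x \<in> cube n"
      then show "\<exists>x'. (\<forall>i<n. 0 \<le> x' i \<and> x' i \<le> 1) \<and>
          (\<forall>j<length us. map (T x) [0..<m] ! j = teval (us ! j) x')"
        using cube_bounds by (intro exI[of _ x]) (auto simp: T_def term_map_def m)
    qed
    finally show ?thesis .
  qed
  let ?G = "term_fun n ` set ts"
  have \<phi>_in: "\<phi> f \<in> S" if "mv_subalgebra (mcn n) S" "?G \<subseteq> S" "f \<in> mcnaughton m" for S f
  proof -
    \<comment> \<open>The added generator leaves the generated subalgebra unchanged, since 0 belongs
      to every subalgebra.\<close>
    have "term_fun n TZero \<in> S"
      using that(1) by (simp add: mv_subalgebra_def term_fun_def)
    then show ?thesis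
      unfolding \<phi>_def using that us by (intro pullback_in_subalgebra) (auto simp: us_def m)
  qed
  have G_mcn: "?G \<subseteq> mcnaughton n"
    using vars by (auto simp: term_fun_eq restrict_teval_mcnaughton)
  have \<phi>_zero: "\<phi> (mv_zero (mcn m)) = mv_zero (mcn n)"
    and \<phi>_neg: "\<And>f. \<phi> (mv_neg (mcn m) f) = mv_neg (mcn n) (\<phi> f)"
    and \<phi>_plus: "\<And>f g. \<phi> (mv_plus (mcn m) f g) = mv_plus (mcn n) (\<phi> f) (\<phi> g)"
    using T_cube unfolding \<phi>_def pullback_def T_def by (auto simp: fun_eq_iff)
  have mcn_m: "mv_subalgebra (mcn m) (mcnaughton m)" by (rule mv_subalgebra_mcn)
  have "mv_subalgebra (mcn n) (\<phi> ` mcnaughton m)"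
    unfolding mv_subalgebra_def
  proof (intro conjI ballI)
    show "\<phi> ` mcnaughton m \<subseteq> carrier (mcn n)"
      using \<phi>_in[OF mv_subalgebra_mcn G_mcn] by auto
    show "mv_zero (mcn n) \<in> \<phi> ` mcnaughton m"
      using mcn_m \<phi>_zero unfolding mv_subalgebra_def by (metis image_eqI)
    show "mv_neg (mcn n) a \<in> \<phi> ` mcnaughton m" if "a \<in> \<phi> ` mcnaughton m" for a
      using mcn_m \<phi>_neg that unfolding mv_subalgebra_def by (metis (no_types, lifting) imageE image_eqI)
    show "mv_plus (mcn n) a b \<in> \<phi> ` mcnaughton m"
      if "a \<in> \<phi> ` mcnaughton m" "b \<in> \<phi> ` mcnaughton m" for a b
      using mcn_m \<phi>_plus that unfolding mv_subalgebra_def by (metis (no_types, lifting) imageE image_eqI)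
  qed
  moreover have "?G \<subseteq> \<phi> ` mcnaughton m"
  proof
    fix g assume "g \<in> ?G"
    then obtain j where j: "j < length ts" "g = term_fun n (ts ! j)"
      by (auto simp: in_set_conv_nth)
    \<comment> \<open>The index is shifted by one because the generator 0 was put in front of the
      list.\<close>
    let ?f = "restrict (teval (TVar (Suc j))) (cube m)"
    have "\<phi> ?f = (\<lambda>x\<in>cube n. T x (Suc j))"
      using T_cube unfolding \<phi>_def pullback_def T_def by (auto simp: fun_eq_iff)
    also have "\<dots> = g"
      using j by (auto simp: T_def term_map_def us_def term_fun_eq fun_eq_iff)
    finally have "g = \<phi> ?f" ..
    moreover have "?f \<in> mcnaughton m"
      using j by (intro restrict_teval_mcnaughton) (auto simp: m us_def)
    ultimately show "g \<in> \<phi> ` mcnaughton m" by blast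
  qed
  \<comment> \<open>The image of \<open>\<phi>\<close> is a subalgebra containing the generators,
    and \<open>\<phi>_in\<close> places it inside every other such subalgebra.\<close>
  ultimately have hull: "mv_subalgebra (mcn n) hull ?G = \<phi> ` mcnaughton m"
    using \<phi>_in by (intro equalityI hull_minimal) (auto simp: hull_def)
  show "mv_isomorphic (mv_generated (mcn n) ?G)
      (mv_quotient (mcn m) (mv_principal_ideal (mcn m) (term_fun m \<sigma>)))"
  proof (rule mv_isomorphic_quotient)
    show "mv_subalgebra (mcn m) (carrier (mcn m))" using mcn_m by simp
    show "\<phi> ` carrier (mcn m) = carrier (mv_generated (mcn n) ?G)"
      by (simp add: mv_generated_def hull)
    then show "\<phi> \<in> mv_hom (mcn m) (mv_generated (mcn n) ?G)"
      using \<phi>_zero \<phi>_neg \<phi>_plus by (auto simp: mv_hom_def mv_generated_def)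
    have "(\<forall>y\<in>cube m. term_fun m \<sigma> y = 0 \<longrightarrow> f y = g y) \<longleftrightarrow> \<phi> f = \<phi> g" for f g
    proof -
      have "(\<forall>y\<in>cube m. term_fun m \<sigma> y = 0 \<longrightarrow> f y = g y) \<longleftrightarrow> (\<forall>x\<in>cube n. f (T x) = g (T x))"
        using T_cube zero_set by (auto simp: term_fun_eq)
      also have "\<dots> \<longleftrightarrow> \<phi> f = \<phi> g"
        by (auto simp: \<phi>_def pullback_def T_def fun_eq_iff restrict_def)
      finally show ?thesis .
    qed
    moreover have "term_fun m \<sigma> \<in> mcnaughton m"
      using \<sigma>_vars by (simp add: term_fun_eq restrict_teval_mcnaughton)
    ultimately show "mv_cong (mcn m) (mv_principal_ideal (mcn m) (term_fun m \<sigma>)) =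
        {(f, g). f \<in> carrier (mcn m) \<and> g \<in> carrier (mcn m) \<and> \<phi> f = \<phi> g}"
      by (simp add: mv_cong_principal_ideal)
  qed
qed

theorem theorem8p1:
  shows "\<exists>p :: recf. \<forall>(n :: nat) (\<tau>s :: mvterm list).
    (\<forall>\<tau>\<in>set \<tau>s. term_vars \<tau> \<subseteq> {..<n}) \<longrightarrow>
    (\<exists>(m :: nat) (\<sigma> :: mvterm).
      rec_eval p [n, list_encode (map term_code \<tau>s)] (prod_encode (m, term_code \<sigma>)) \<and>
      m > 0 \<and> term_vars \<sigma> \<subseteq> {..<m} \<and>
      mv_isomorphic
        (mv_generated (mcn n) (term_fun n ` set \<tau>s))
        (mv_quotient (mcn m) (mv_principal_ideal (mcn m) (term_fun m \<sigma>))))"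
proof -
  obtain q where q: "\<And>x. rec_eval q [enc x] (enc (present x))"
    using computable_present by (auto simp: computable_def)
  show ?thesis
  \<comment> \<open>The required program takes two arguments, whereas \<open>computable\<close>
    provides one for the code of a pair; the pairing program is run first.\<close>
  proof (intro exI[of _ "RComp q [rpair]"] allI impI)
    fix n \<tau>s assume vars: "\<forall>\<tau>\<in>set \<tau>s. term_vars \<tau> \<subseteq> {..<n}"
    obtain m \<sigma> where \<sigma>: "present (n, \<tau>s) = (m, \<sigma>)" by force
    have [simp]: "map enc \<tau>s = map term_code \<tau>s" by (simp add: enc_mvterm_def)
    have "rec_eval q [prod_encode (n, list_encode (map term_code \<tau>s))]
        (prod_encode (m, term_code \<sigma>))"
      using q[of "(n, \<tau>s)"]
      by (simp add: \<sigma> enc_prod_def enc_nat_def enc_list_def enc_mvterm_def)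
    then have "rec_eval (RComp q [rpair]) [n, list_encode (map term_code \<tau>s)]
        (prod_encode (m, term_code \<sigma>))"
      by (rule rec_eval_comp1[OF rec_eval_rpair])
    then show "\<exists>m \<sigma>. rec_eval (RComp q [rpair]) [n, list_encode (map term_code \<tau>s)]
          (prod_encode (m, term_code \<sigma>)) \<and>
        m > 0 \<and> term_vars \<sigma> \<subseteq> {..<m} \<and>
        mv_isomorphic (mv_generated (mcn n) (term_fun n ` set \<tau>s))
          (mv_quotient (mcn m) (mv_principal_ideal (mcn m) (term_fun m \<sigma>)))"
      using present_correct[OF _ \<sigma>] vars by blast
  qed
qed

end
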